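(* Each of the following statistics on set partitions exhibits the cyclic sieving phenomenon with respect to involutions having $F_{2n-1}$ fixed points: the number of non-exclusive records; the number of non-exclusive-record openers; crossings; nestings; crossings of opener type; nestings of opener type; the number of non-block-records (insiders and openers that are not block records); the number of openers that are not block records; overlaps; coverings.
   Context: $\Pi_n$ is the set of set partitions of $[n]$. $F_{2n-1}$ denotes the sequence $a_n$ with $a_0=a_1=1$ and $a_n=3a_{n-1}-a_{n-2}$ (odd-indexed Fibonacci numbers $1,1,2,5,13,34,\dots$). For $\pi\in\Pi_n$, an element $i$ is an opener if it is the smallest element of a block of size $\ge2$, a closer if it is the largest element of a block of size $\ge2$, an insider if it is in a block of size $\ge3$ and is neither its smallest nor largest element, a singleton if its block is $\{i\}$. For $i$ not the largest element of its block, its right neighbour is the next larger element of its block; such an $i$ is an exclusive record if its right neighbour is larger than the right neighbour of every $j<i$ that is not the largest element of its block. Non-exclusive records = elements that are not the largest of their block and are not exclusive records; non-exclusive-record openers = openers that are not exclusive records. The partition graph has an edge $\{a,b\}$ iff $a,b$ are consecutive elements of the same block. A crossing is a quadruple $i<j<k<l$ with edges $\{i,k\},\{j,l\}$; a nesting is $i<j<k<l$ with edges $\{i,l\},\{j,k\}$; it is of opener type if $j$ is an opener. An element $j$ that is an opener or insider is a block record if $\max$ of its block exceeds $\max$ of every block containing an element $<j$. For blocks $B_1,B_2$: $(B_1,B_2)$ is an overlap if $\min B_1<\min B_2<\max B_1<\max B_2$, a covering if $\min B_1<\min B_2<\max B_2<\max B_1$. Cyclic sieving for involutions: for an involution $\phi$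 on a finite set $X$ and polynomial $f$, $(X,\{\mathrm{id},\phi\},f)$ exhibits the CSP iff $f(1)=|X|$ and $f(-1)$ equals the number of fixed points of $\phi$; a statistic exhibits the CSP with respect to involutions having $a_n$ fixed points if for every $n\ge0$ and every involution $\phi$ of $\Pi_n$ with exactly $a_n$ fixed points, $(\Pi_n,\{\mathrm{id},\phi\},\sum_{\pi\in\Pi_n}q^{\mathrm{stat}(\pi)})$ exhibits the CSP.
   Formalization: In the definition of a block record, the maximum of the block of j is compared only with the maxima of other blocks containing an element < j; read literally, no insider could be a block record and the claim for non-block-records fails at n=3 (f(-1)=3, not 5). *)

theory Defs
  imports "HOL-Library.Disjoint_Sets" "HOL-Computational_Algebra.Polynomial"
begin

definition set_partitions :: "nat \<Rightarrow> nat set set set" where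
  "set_partitions n = {P. partition_on {1..n} P}"

(* fib_odd n is F_{2n-1}, with F_{-1} = F_1 = 1; integer-valued so that the subtraction does not
   truncate. *)
fun fib_odd :: "nat \<Rightarrow> int" where
  "fib_odd 0 = 1"
| "fib_odd (Suc 0) = 1"
| "fib_odd (Suc (Suc n)) = 3 * fib_odd (Suc n) - fib_odd n"

definition block :: "nat set set \<Rightarrow> nat \<Rightarrow> nat set" where
  "block P i = (THE B. B \<in> P \<and> i \<in> B)"

definition opener :: "nat set set \<Rightarrow> nat \<Rightarrow> bool" where
  "opener P i \<longleftrightarrow> i \<in> \<Union>P \<and> card (block P i) \<ge> 2 \<and> i = Min (block P i)"

definition insider :: "nat set set \<Rightarrow> nat \<Rightarrow> bool" where
  "insider P i \<longleftrightarrow> i \<in> \<Union>P \<and> card (block P i) \<ge> 3 \<and>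
     i \<noteq> Min (block P i) \<and> i \<noteq> Max (block P i)"

definition non_largest :: "nat set set \<Rightarrow> nat \<Rightarrow> bool" where
  "non_largest P i \<longleftrightarrow> i \<in> \<Union>P \<and> i \<noteq> Max (block P i)"

definition right_neighbour :: "nat set set \<Rightarrow> nat \<Rightarrow> nat" where
  "right_neighbour P i = Min {k \<in> block P i. i < k}"

definition exclusive_record :: "nat set set \<Rightarrow> nat \<Rightarrow> bool" where
  "exclusive_record P i \<longleftrightarrow> non_largest P i \<and>
     (\<forall>j<i. non_largest P j \<longrightarrow> right_neighbour P j < right_neighbour P i)"

definition edges :: "nat set set \<Rightarrow> nat set set" where
  "edges P = {{a, b} | a b. a < b \<and> (\<exists>B\<in>P. a \<in> B \<and> b \<in> B \<and> \<not> (\<exists>c\<in>B. a < c \<and> c < b))}"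

definition crossings :: "nat set set \<Rightarrow> (nat \<times> nat \<times> nat \<times> nat) set" where
  "crossings P = {(i, j, k, l). i < j \<and> j < k \<and> k < l \<and> {i, k} \<in> edges P \<and> {j, l} \<in> edges P}"

definition nestings :: "nat set set \<Rightarrow> (nat \<times> nat \<times> nat \<times> nat) set" where
  "nestings P = {(i, j, k, l). i < j \<and> j < k \<and> k < l \<and> {i, l} \<in> edges P \<and> {j, k} \<in> edges P}"

(* Only blocks other than the block of j are compared: the block of an insider j itself contains
   an element smaller than j, so otherwise no insider could ever be a block record. For openers
   the restriction makes no difference. *)
definition block_record :: "nat set set \<Rightarrow> nat \<Rightarrow> bool" where
  "block_record P j \<longleftrightarrow> (opener P j \<or> insider P j) \<and>
     (\<forall>B\<in>P. B \<noteq> block P j \<and> (\<exists>x\<in>B. x < j) \<longrightarrow> Max B < Max (block P j))"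

definition overlaps :: "nat set set \<Rightarrow> (nat set \<times> nat set) set" where
  "overlaps P = {(B1, B2). B1 \<in> P \<and> B2 \<in> P \<and>
     Min B1 < Min B2 \<and> Min B2 < Max B1 \<and> Max B1 < Max B2}"

definition coverings :: "nat set set \<Rightarrow> (nat set \<times> nat set) set" where
  "coverings P = {(B1, B2). B1 \<in> P \<and> B2 \<in> P \<and>
     Min B1 < Min B2 \<and> Min B2 < Max B2 \<and> Max B2 < Max B1}"

definition num_non_exclusive_records :: "nat set set \<Rightarrow> nat" where
  "num_non_exclusive_records P = card {i. non_largest P i \<and> \<not> exclusive_record P i}"

definition num_non_exclusive_record_openers :: "nat set set \<Rightarrow> nat" where
  "num_non_exclusive_record_openers P = card {i. opener P i \<and> \<not> exclusive_record P i}"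

definition num_crossings :: "nat set set \<Rightarrow> nat" where
  "num_crossings P = card (crossings P)"

definition num_nestings :: "nat set set \<Rightarrow> nat" where
  "num_nestings P = card (nestings P)"

definition num_opener_crossings :: "nat set set \<Rightarrow> nat" where
  "num_opener_crossings P = card {(i, j, k, l). (i, j, k, l) \<in> crossings P \<and> opener P j}"

definition num_opener_nestings :: "nat set set \<Rightarrow> nat" where
  "num_opener_nestings P = card {(i, j, k, l). (i, j, k, l) \<in> nestings P \<and> opener P j}"

definition num_non_block_records :: "nat set set \<Rightarrow> nat" where
  "num_non_block_records P = card {j. (opener P j \<or> insider P j) \<and> \<not> block_record P j}"

definition num_non_block_record_openers :: "nat set set \<Rightarrow> nat" where
  "num_non_block_record_openers P = card {j. opener P j \<and> \<not> block_record P j}"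

definition num_overlaps :: "nat set set \<Rightarrow> nat" where
  "num_overlaps P = card (overlaps P)"

definition num_coverings :: "nat set set \<Rightarrow> nat" where
  "num_coverings P = card (coverings P)"

definition involution_on :: "'a set \<Rightarrow> ('a \<Rightarrow> 'a) \<Rightarrow> bool" where
  "involution_on X \<phi> \<longleftrightarrow> (\<forall>x\<in>X. \<phi> x \<in> X \<and> \<phi> (\<phi> x) = x)"

definition fixed_points :: "'a set \<Rightarrow> ('a \<Rightarrow> 'a) \<Rightarrow> 'a set" where
  "fixed_points X \<phi> = {x \<in> X. \<phi> x = x}"

(* Cyclic sieving for the group generated by an involution phi on a finite set X. *)
definition csp_involution :: "'a set \<Rightarrow> ('a \<Rightarrow> 'a) \<Rightarrow> int poly \<Rightarrow> bool" where
  "csp_involution X \<phi> f \<longleftrightarrow>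
     poly f 1 = int (card X) \<and> poly f (-1) = int (card (fixed_points X \<phi>))"

definition stat_gen_poly :: "(nat set set \<Rightarrow> nat) \<Rightarrow> nat \<Rightarrow> int poly" where
  "stat_gen_poly stat n = (\<Sum>P\<in>set_partitions n. monom 1 (stat P))"

definition exhibits_csp :: "(nat set set \<Rightarrow> nat) \<Rightarrow> (nat \<Rightarrow> int) \<Rightarrow> bool" where
  "exhibits_csp stat a \<longleftrightarrow>
     (\<forall>n \<phi>. involution_on (set_partitions n) \<phi> \<and>
        int (card (fixed_points (set_partitions n) \<phi>)) = a n \<longrightarrow>
        csp_involution (set_partitions n) \<phi> (stat_gen_poly stat n))"

end

theory Submission
  imports Defs "HOL-Combinatorics.Transposition"
begin

text \<open>
  Call \<open>j\<close> covered if \<open>j\<close> is not the largest element of its block and another block has elements on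
  both sides of \<open>j\<close>. Let \<open>j\<close> be the least covered element. Then \<open>j\<close> is the minimum of its block \<open>B\<close>,
  and a unique other block \<open>A\<close> straddles \<open>j\<close>. Exchanging the parts of \<open>A\<close> and \<open>B\<close> above \<open>j\<close> is an
  involution on the partitions having a covered element; it swaps the right neighbours of \<open>j\<close> and of
  the last element of \<open>A\<close> before \<open>j\<close>, and it swaps the maxima of the blocks with minima \<open>j\<close> and
  \<open>Min A\<close>. Since nothing before \<open>j\<close> is covered, this one map changes the parity of all ten
  statistics. All ten vanish on the partitions without covered elements. If \<open>g n\<close> counts the latter,
  then in such a partition of \<open>{1..n+2}\<close> either \<open>n+2\<close> is a singleton, or \<open>n+1\<close> and \<open>n+2\<close> share a
  block, or \<open>n+1\<close> is a singleton and \<open>n+2\<close> is not; hence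
  \<open>g (n+2) = g (n+1) + g (n+1) + (g (n+1) - g n)\<close>.
\<close>

section \<open>Neighbours and block records\<close>

lemma block_eq:
  assumes "partition_on X P" "C \<in> P" "x \<in> C"
  shows "block P x = C"
  unfolding block_def
proof (rule the_equality)
  show "C \<in> P \<and> x \<in> C" using assms by blast
next
  fix D assume "D \<in> P \<and> x \<in> D"
  then show "D = C"
    using partition_onD2[OF assms(1)] assms(2,3) by (metis disjointD disjoint_iff)
qed

lemma block_mem:
  assumes "partition_on X P" "x \<in> X"
  shows "block P x \<in> P" "x \<in> block P x"
proof -
  obtain C where "C \<in> P" "x \<in> C" using partition_onD1[OF assms(1)] assms(2) by blast
  then show "block P x \<in> P" "x \<in> block P x" using block_eq[OF assms(1)] by metis+
qed

lemma blocks_eq: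
  fixes P :: "nat set set"
  assumes "partition_on X P" "C \<in> P" "D \<in> P" "x \<in> C" "x \<in> D"
  shows "C = D"
  using block_eq[OF assms(1,2,4)] block_eq[OF assms(1,3,5)] by simp

lemma block_finite:
  assumes "partition_on X P" "finite X" "C \<in> P"
  shows "finite C"
  using assms partition_onD1 by (metis Union_upper finite_subset)

lemma block_nonempty: "partition_on X P \<Longrightarrow> C \<in> P \<Longrightarrow> C \<noteq> {}"
  using partition_onD3 by metis

lemma block_subset: "partition_on X P \<Longrightarrow> C \<in> P \<Longrightarrow> x \<in> C \<Longrightarrow> x \<in> X"
  by (drule partition_onD1) blast

lemma non_largest_iff:
  assumes "partition_on X P" "finite X"
  shows "non_largest P x \<longleftrightarrow> x \<in> X \<and> (\<exists>y\<in>block P x. x < y)"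
proof (cases "x \<in> X")
  case True
  note b = block_mem[OF assms(1) True]
  have f: "finite (block P x)" using block_finite[OF assms b(1)] .
  have "x \<noteq> Max (block P x) \<longleftrightarrow> (\<exists>y\<in>block P x. x < y)"
    using Max_in[OF f] Max_ge[OF f] b(2) by (metis empty_iff leD nless_le)
  then show ?thesis using True partition_onD1[OF assms(1)] by (auto simp: non_largest_def)
qed (use partition_onD1[OF assms(1)] in \<open>auto simp: non_largest_def\<close>)

lemma opener_iff:
  assumes "partition_on X P" "finite X"
  shows "opener P x \<longleftrightarrow> non_largest P x \<and> (\<forall>y\<in>block P x. x \<le> y)"
proof (cases "x \<in> X")
  case True
  note b = block_mem[OF assms(1) True]
  have f: "finite (block P x)" using block_finite[OF assms b(1)] .
  have m: "x = Min (block P x) \<longleftrightarrow> (\<forall>y\<in>block P x. x \<le> y)"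
    using Min_eq_iff[OF f] b(2) by (metis empty_iff)
  have "card (block P x) \<ge> 2 \<longleftrightarrow> (\<exists>y\<in>block P x. y \<noteq> x)"
  proof
    assume "card (block P x) \<ge> 2"
    then have "\<not> block P x \<subseteq> {x}" by (metis One_nat_def Suc_1 card_mono card.empty card_insert_disjoint empty_iff finite.emptyI finite.insertI not_less_eq_eq)
    then show "\<exists>y\<in>block P x. y \<noteq> x" by blast
  next
    assume "\<exists>y\<in>block P x. y \<noteq> x"
    then obtain y where "y \<in> block P x" "y \<noteq> x" by blast
    then have "card {x, y} \<le> card (block P x)" using b f by (intro card_mono) auto
    then show "card (block P x) \<ge> 2" using \<open>y \<noteq> x\<close> by simp
  qed
  then show ?thesis
    using True m partition_onD1[OF assms(1)] non_largest_iff[OF assms, of x]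
    unfolding opener_def by (metis nless_le order_less_imp_not_eq2)
qed (use partition_onD1[OF assms(1)] in \<open>auto simp: non_largest_def opener_def\<close>)

text \<open>A non-largest element that is not minimal has a block mate on each side, so its block
  has at least three elements.\<close>

lemma opener_or_insider_iff:
  assumes "partition_on X P" "finite X"
  shows "opener P x \<or> insider P x \<longleftrightarrow> non_largest P x"
proof (cases "x \<in> X")
  case True
  note b = block_mem[OF assms(1) True]
  have f: "finite (block P x)" using block_finite[OF assms b(1)] .
  have "insider P x" if nl: "non_largest P x" and no: "\<not> opener P x"
  proof -
    obtain y z where yz: "y \<in> block P x" "x < y" "z \<in> block P x" "z < x"
      using nl no opener_iff[OF assms] non_largest_iff[OF assms] by (meson not_le)
    then have "card {z, x, y} \<le> card (block P x)" using b f by (intro card_mono) auto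
    moreover have "card {z, x, y} = 3" using yz by simp
    moreover have "x \<noteq> Min (block P x)" "x \<noteq> Max (block P x)"
      using yz f by (metis Min_le leD, metis Max_ge leD)
    ultimately show ?thesis using nl by (auto simp: insider_def non_largest_def)
  qed
  moreover have "insider P x \<Longrightarrow> non_largest P x" by (auto simp: insider_def non_largest_def)
  ultimately show ?thesis using opener_iff[OF assms] by blast
qed (use partition_onD1[OF assms(1)] in \<open>auto simp: non_largest_def opener_def insider_def\<close>)

lemma right_neighbour:
  assumes "partition_on X P" "finite X" "non_largest P x"
  shows "right_neighbour P x \<in> block P x" "x < right_neighbour P x"
    "\<And>y. y \<in> block P x \<Longrightarrow> x < y \<Longrightarrow> right_neighbour P x \<le> y"
proof -
  have x: "x \<in> X" "{k \<in> block P x. x < k} \<noteq> {}"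
    using non_largest_iff[OF assms(1,2)] assms(3) by auto
  have f: "finite {k \<in> block P x. x < k}"
    using block_finite[OF assms(1,2) block_mem(1)[OF assms(1) x(1)]] by simp
  show "right_neighbour P x \<in> block P x" "x < right_neighbour P x"
    using Min_in[OF f x(2)] unfolding right_neighbour_def by auto
  show "\<And>y. y \<in> block P x \<Longrightarrow> x < y \<Longrightarrow> right_neighbour P x \<le> y"
    using Min_le[OF f] unfolding right_neighbour_def by auto
qed

lemma non_largest_mem: "partition_on X P \<Longrightarrow> non_largest P x \<Longrightarrow> x \<in> X"
  unfolding non_largest_def by (drule partition_onD1) blast

text \<open>Equal right neighbours force a common block, and there the smaller of two elements has a
  right neighbour not exceeding the larger one.\<close>

lemma inj_on_right_neighbour:
  assumes "partition_on X P" "finite X"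
  shows "inj_on (right_neighbour P) {x. non_largest P x}"
proof (rule inj_onI, clarsimp)
  fix x y assume x: "non_largest P x" and y: "non_largest P y"
    and e: "right_neighbour P x = right_neighbour P y"
  note rx = right_neighbour[OF assms x] and ry = right_neighbour[OF assms y]
  note bx = block_mem[OF assms(1) non_largest_mem[OF assms(1) x]]
  note b_y = block_mem[OF assms(1) non_largest_mem[OF assms(1) y]]
  have eq: "block P x = block P y"
    using blocks_eq[OF assms(1) bx(1) b_y(1) rx(1)] ry(1) e by simp
  show "x = y"
  proof (rule linorder_cases[of x y])
    assume "x < y" then show ?thesis using rx(3)[of y] ry(2) e eq b_y(2) by simp
  next
    assume "y < x" then show ?thesis using ry(3)[of x] rx(2) e eq bx(2) by simp
  qed simp
qed

text \<open>An unordered edge becomes an arc directed from its smaller end, so that crossings and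
  nestings can be described by left ends alone.\<close>

lemma edges_iff:
  assumes "partition_on X P" "finite X" "a < b"
  shows "{a, b} \<in> edges P \<longleftrightarrow> non_largest P a \<and> right_neighbour P a = b"
proof
  assume "{a, b} \<in> edges P"
  then obtain c d B where "{a, b} = {c, d}" "c < d" "B \<in> P" "c \<in> B" "d \<in> B"
    "\<not> (\<exists>e\<in>B. c < e \<and> e < d)" unfolding edges_def by blast
  then have B: "B \<in> P" "a \<in> B" "b \<in> B" "\<not> (\<exists>e\<in>B. a < e \<and> e < b)"
    using assms(3) by (auto simp: doubleton_eq_iff)
  have e: "block P a = B" using block_eq[OF assms(1) B(1,2)] .
  have nl: "non_largest P a" using non_largest_iff[OF assms(1,2)] B assms e block_subset by metis
  moreover have "right_neighbour P a = b"
    using right_neighbour[OF assms(1,2) nl] B e assms(3) by (metis le_neq_implies_less)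
  ultimately show "non_largest P a \<and> right_neighbour P a = b" by blast
next
  assume a: "non_largest P a \<and> right_neighbour P a = b"
  note r = right_neighbour[OF assms(1,2) conjunct1[OF a]]
  have "a \<in> X" using a non_largest_mem[OF assms(1)] by blast
  then have "block P a \<in> P" "a \<in> block P a" using block_mem[OF assms(1)] by auto
  then show "{a, b} \<in> edges P" unfolding edges_def using r a by (blast dest: leD)
qed

text \<open>Arcs lead from \<open>x \<in> N\<close> to \<open>r x\<close> and are named by their
  left ends. \<open>K\<close> filters the second left end: \<open>UNIV\<close> admits all pairs,
  \<open>openers P\<close> those of opener type.\<close>

definition arc_crossings :: "nat set \<Rightarrow> (nat \<Rightarrow> nat) \<Rightarrow> nat set \<Rightarrow> (nat \<times> nat) set" where
  "arc_crossings N r K = {(a, b). a \<in> N \<and> b \<in> N \<and> b \<in> K \<and> a < b \<and> b < r a \<and> r a < r b}"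

definition arc_nestings :: "nat set \<Rightarrow> (nat \<Rightarrow> nat) \<Rightarrow> nat set \<Rightarrow> (nat \<times> nat) set" where
  "arc_nestings N r K = {(a, b). a \<in> N \<and> b \<in> N \<and> b \<in> K \<and> a < b \<and> r b < r a}"

text \<open>These encode the elements failing to be records, each counted once however many arcs
  enclose its own.\<close>

definition nested_points :: "nat set \<Rightarrow> (nat \<Rightarrow> nat) \<Rightarrow> nat set \<Rightarrow> nat set" where
  "nested_points N r K = snd ` arc_nestings N r K"

lemma nested_points_iff: "b \<in> nested_points N r K \<longleftrightarrow> b \<in> N \<and> b \<in> K \<and> (\<exists>a\<in>N. a < b \<and> r b < r a)"
  unfolding nested_points_def arc_nestings_def by force

lemma finite_arcs:
  assumes "finite N"
  shows "finite (arc_crossings N r K)" "finite (arc_nestings N r K)" "finite (nested_points N r K)"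
proof -
  have "arc_crossings N r K \<subseteq> N \<times> N" "arc_nestings N r K \<subseteq> N \<times> N"
    by (auto simp: arc_crossings_def arc_nestings_def)
  then show "finite (arc_crossings N r K)" "finite (arc_nestings N r K)"
    using assms by (meson finite_SigmaI finite_subset)+
  then show "finite (nested_points N r K)" by (simp add: nested_points_def)
qed

abbreviation non_largests :: "nat set set \<Rightarrow> nat set" where
  "non_largests P \<equiv> {x. non_largest P x}"

abbreviation openers :: "nat set set \<Rightarrow> nat set" where
  "openers P \<equiv> {x. opener P x}"

abbreviation block_max :: "nat set set \<Rightarrow> nat \<Rightarrow> nat" where
  "block_max P x \<equiv> Max (block P x)"

section \<open>The ten statistics as counts over arcs\<close>

lemma crossings_card:
  assumes "partition_on X P" "finite X"
  shows "card {(i, j, k, l). (i, j, k, l) \<in> crossings P \<and> j \<in> K}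
    = card (arc_crossings (non_largests P) (right_neighbour P) K)"
proof (rule bij_betw_same_card[symmetric])
  let ?r = "right_neighbour P"
  \<comment> \<open>Right ends are functions of left ends, so a quadruple is recovered from its
    first two entries.\<close>
  show "bij_betw (\<lambda>(a, b). (a, b, ?r a, ?r b)) (arc_crossings (non_largests P) ?r K)
     {(i, j, k, l). (i, j, k, l) \<in> crossings P \<and> j \<in> K}"
    by (rule bij_betw_byWitness[where f' = "\<lambda>(a, b, c, d). (a, b)"])
      (auto simp: arc_crossings_def crossings_def edges_iff[OF assms])
qed

lemma nestings_card:
  assumes "partition_on X P" "finite X"
  shows "card {(i, j, k, l). (i, j, k, l) \<in> nestings P \<and> j \<in> K}
    = card (arc_nestings (non_largests P) (right_neighbour P) K)"
proof (rule bij_betw_same_card[symmetric])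
  let ?r = "right_neighbour P"
  show "bij_betw (\<lambda>(a, b). (a, b, ?r b, ?r a)) (arc_nestings (non_largests P) ?r K)
     {(i, j, k, l). (i, j, k, l) \<in> nestings P \<and> j \<in> K}"
    by (rule bij_betw_byWitness[where f' = "\<lambda>(a, b, c, d). (a, b)"])
      (auto simp: arc_nestings_def nestings_def edges_iff[OF assms] right_neighbour[OF assms])
qed

text \<open>The negated definition gives a weak inequality; injectivity of the right neighbour makes
  it strict.\<close>

lemma non_exclusive_iff:
  assumes "partition_on X P" "finite X" "non_largest P x"
  shows "\<not> exclusive_record P x \<longleftrightarrow>
    (\<exists>a\<in>non_largests P. a < x \<and> right_neighbour P x < right_neighbour P a)"
proof -
  have "right_neighbour P a \<noteq> right_neighbour P x" if "non_largest P a" "a < x" for a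
    using inj_on_right_neighbour[OF assms(1,2)] that assms(3) by (auto dest: inj_onD)
  then show ?thesis using assms(3) unfolding exclusive_record_def
    by (metis linorder_neqE_nat mem_Collect_eq not_less_iff_gr_or_eq)
qed

lemma block_max:
  assumes "partition_on X P" "finite X" "x \<in> X"
  shows "block_max P x \<in> block P x" "\<And>y. y \<in> block P x \<Longrightarrow> y \<le> block_max P x"
  using block_finite[OF assms(1,2) block_mem(1)[OF assms(1,3)]] block_mem(2)[OF assms(1,3)]
  by (metis Max_in empty_iff, metis Max_ge)

text \<open>Distinct blocks have distinct maxima, so the comparison may be made strict; strictness
  in turn rules out the block of \<open>x\<close> itself.\<close>

lemma non_block_record_iff:
  assumes "partition_on X P" "finite X" "non_largest P x"
  shows "\<not> block_record P x \<longleftrightarrow> (\<exists>a\<in>X. a < x \<and> block_max P x < block_max P a)"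
proof -
  have x: "x \<in> X" using non_largest_mem assms by blast
  note bx = block_mem[OF assms(1) x] and mx = block_max[OF assms(1,2) x]
  have "\<not> block_record P x \<longleftrightarrow> (\<exists>B\<in>P. B \<noteq> block P x \<and> (\<exists>a\<in>B. a < x) \<and> Max (block P x) \<le> Max B)"
    using opener_or_insider_iff[OF assms(1,2)] assms(3) unfolding block_record_def by (meson not_le)
  also have "\<dots> \<longleftrightarrow> (\<exists>a\<in>X. a < x \<and> block_max P x < block_max P a)"
  proof (intro iffI; elim bexE conjE)
    fix B a assume B: "B \<in> P" "B \<noteq> block P x" "a \<in> B" "a < x" "Max (block P x) \<le> Max B"
    have a: "block P a = B" "a \<in> X" using block_eq[OF assms(1) B(1,3)] block_subset[OF assms(1) B(1,3)] by auto
    have "Max B \<noteq> Max (block P x)"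
      using block_max(1)[OF assms(1,2) a(2)] mx(1) a B(1,2) bx(1) blocks_eq[OF assms(1)] by metis
    then show "\<exists>a\<in>X. a < x \<and> block_max P x < block_max P a" using a B by force
  next
    fix a assume "a \<in> X" "a < x" "block_max P x < block_max P a"
    then show "\<exists>B\<in>P. B \<noteq> block P x \<and> (\<exists>a\<in>B. a < x) \<and> Max (block P x) \<le> Max B"
      using block_mem[OF assms(1)] by (intro bexI[of _ "block P a"]) auto
  qed
  finally show ?thesis .
qed

lemma block_min_opener:
  assumes "partition_on X P" "finite X" "a \<in> X" "a < block_max P a"
  shows "opener P (Min (block P a))" "block P (Min (block P a)) = block P a"
    "Min (block P a) \<le> a"
proof -
  note b = block_mem[OF assms(1,3)]
  have f: "finite (block P a)" using block_finite[OF assms(1,2) b(1)] .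
  have m: "Min (block P a) \<in> block P a" "Min (block P a) \<le> a" using f b Min_in by auto
  show "Min (block P a) \<le> a" by fact
  show e: "block P (Min (block P a)) = block P a" using block_eq[OF assms(1) b(1) m(1)] .
  have "Min (block P a) \<in> X" using block_subset[OF assms(1) b(1) m(1)] .
  moreover have "Min (block P a) < block_max P a" using m assms(4) by simp
  ultimately have "non_largest P (Min (block P a))"
    using non_largest_iff[OF assms(1,2)] e block_max(1)[OF assms(1,2,3)] by metis
  then show "opener P (Min (block P a))" using opener_iff[OF assms(1,2)] e f by auto
qed

lemma non_largest_less_block_max:
  assumes "partition_on X P" "finite X" "non_largest P x"
  shows "x < block_max P x"
  using assms non_largest_iff[OF assms(1,2)] block_max(2)[OF assms(1,2)] by (meson less_le_trans)

text \<open>A witness \<open>a\<close> has \<open>a < x < block_max P x < block_max P a\<close>, so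
  the minimum of its block is an opener with the same block maximum, still below
  \<open>x\<close>.\<close>

lemma non_block_record_iff_opener:
  assumes "partition_on X P" "finite X" "non_largest P x"
  shows "\<not> block_record P x \<longleftrightarrow> (\<exists>a\<in>openers P. a < x \<and> block_max P x < block_max P a)"
proof -
  have "\<exists>a\<in>openers P. a < x \<and> block_max P x < block_max P a"
    if "a \<in> X" "a < x" "block_max P x < block_max P a" for a
  proof -
    have "a < block_max P a" using non_largest_less_block_max[OF assms] that by simp
    then show ?thesis using block_min_opener[OF assms(1,2) that(1)] that by force
  qed
  moreover have "openers P \<subseteq> X" using opener_iff[OF assms(1,2)] non_largest_mem[OF assms(1)] by blast
  ultimately show ?thesis using non_block_record_iff[OF assms] by blast
qed

text \<open>Two arc systems occur: non-largest elements with right neighbours, and openers with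
  block maxima. Only \<open>num_non_block_records\<close> mixes them, taking block maxima over all
  non-largest elements.\<close>

lemma stats_eq:
  assumes "partition_on X P" "finite X"
  shows
    "num_non_exclusive_records P = card (nested_points (non_largests P) (right_neighbour P) UNIV)"
    "num_non_exclusive_record_openers P =
      card (nested_points (non_largests P) (right_neighbour P) (openers P))"
    "num_crossings P = card (arc_crossings (non_largests P) (right_neighbour P) UNIV)"
    "num_nestings P = card (arc_nestings (non_largests P) (right_neighbour P) UNIV)"
    "num_opener_crossings P = card (arc_crossings (non_largests P) (right_neighbour P) (openers P))"
    "num_opener_nestings P = card (arc_nestings (non_largests P) (right_neighbour P) (openers P))"
    "num_non_block_records P = card (nested_points (non_largests P) (block_max P) UNIV)"
    "num_non_block_record_openers P = card (nested_points (openers P) (block_max P) UNIV)"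
    "num_overlaps P = card (arc_crossings (openers P) (block_max P) UNIV)"
    "num_coverings P = card (arc_nestings (openers P) (block_max P) UNIV)"
proof -
  have sub: "opener P x \<Longrightarrow> non_largest P x" for x using opener_iff[OF assms] by blast
  have nx: "{x. non_largest P x \<and> x \<in> K \<and> \<not> exclusive_record P x} =
      nested_points (non_largests P) (right_neighbour P) K" for K
  proof (rule set_eqI)
    fix x
    show "x \<in> {x. non_largest P x \<and> x \<in> K \<and> \<not> exclusive_record P x} \<longleftrightarrow>
        x \<in> nested_points (non_largests P) (right_neighbour P) K"
      using non_exclusive_iff[OF assms, of x] unfolding nested_points_iff by blast
  qed
  show "num_non_exclusive_records P = card (nested_points (non_largests P) (right_neighbour P) UNIV)"
    using nx[of UNIV] by (simp add: num_non_exclusive_records_def)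
  have "{x. opener P x \<and> \<not> exclusive_record P x} =
      {x. non_largest P x \<and> x \<in> openers P \<and> \<not> exclusive_record P x}"
    using sub by blast
  then show "num_non_exclusive_record_openers P =
      card (nested_points (non_largests P) (right_neighbour P) (openers P))"
    unfolding num_non_exclusive_record_openers_def nx by simp
  show "num_crossings P = card (arc_crossings (non_largests P) (right_neighbour P) UNIV)"
    using crossings_card[OF assms, of UNIV] by (simp add: num_crossings_def)
  show "num_nestings P = card (arc_nestings (non_largests P) (right_neighbour P) UNIV)"
    using nestings_card[OF assms, of UNIV] by (simp add: num_nestings_def)
  show "num_opener_crossings P = card (arc_crossings (non_largests P) (right_neighbour P) (openers P))"
    using crossings_card[OF assms, of "openers P"] by (simp add: num_opener_crossings_def)
  show "num_opener_nestings P = card (arc_nestings (non_largests P) (right_neighbour P) (openers P))"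
    using nestings_card[OF assms, of "openers P"] by (simp add: num_opener_nestings_def)
  \<comment> \<open>With \<open>N\<close> anywhere between the openers and the non-largest elements,
    one argument serves both block-record statistics: a witness in \<open>N\<close> is a witness in
    \<open>X\<close>, and conversely an opener can be chosen.\<close>
  have nb: "{x. x \<in> N \<and> \<not> block_record P x} = nested_points N (block_max P) UNIV"
    if N: "openers P \<subseteq> N" "N \<subseteq> non_largests P" for N
  proof (rule set_eqI)
    fix x
    show "x \<in> {x. x \<in> N \<and> \<not> block_record P x} \<longleftrightarrow> x \<in> nested_points N (block_max P) UNIV"
      using non_block_record_iff_opener[OF assms, of x] non_block_record_iff[OF assms, of x] N
        non_largest_mem[OF assms(1)] unfolding nested_points_iff by blast
  qed
  show "num_non_block_records P = card (nested_points (non_largests P) (block_max P) UNIV)"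
    unfolding num_non_block_records_def opener_or_insider_iff[OF assms]
    using nb[of "non_largests P"] sub by fastforce
  show "num_non_block_record_openers P = card (nested_points (openers P) (block_max P) UNIV)"
    unfolding num_non_block_record_openers_def using nb[of "openers P"] sub by fastforce
  \<comment> \<open>Overlapping or covering blocks have at least two elements, so they correspond to
    their minima, which are openers.\<close>
  have op: "opener P (Min B)" "block P (Min B) = B" if "B \<in> P" "Min B < Max B" for B
  proof -
    have f: "finite B" "B \<noteq> {}" using block_finite[OF assms that(1)] block_nonempty[OF assms(1) that(1)] by auto
    note m = Min_in[OF f]
    show e: "block P (Min B) = B" using block_eq[OF assms(1) that(1) m] .
    show "opener P (Min B)"
      using block_min_opener(1)[OF assms block_subset[OF assms(1) that(1) m]] that e by simp
  qed
  have op': "block P a \<in> P" "Min (block P a) = a" if "opener P a" for a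
    using that block_mem[OF assms(1)] by (auto simp: opener_def partition_onD1[OF assms(1), symmetric])
  show "num_overlaps P = card (arc_crossings (openers P) (block_max P) UNIV)"
    unfolding num_overlaps_def
  proof (rule bij_betw_same_card, rule bij_betw_byWitness[where f = "\<lambda>(A, B). (Min A, Min B)"
        and f' = "\<lambda>(a, b). (block P a, block P b)"])
  qed (auto simp: overlaps_def arc_crossings_def op op')
  show "num_coverings P = card (arc_nestings (openers P) (block_max P) UNIV)"
    unfolding num_coverings_def
  proof (rule bij_betw_same_card, rule bij_betw_byWitness[where f = "\<lambda>(A, B). (Min A, Min B)"
        and f' = "\<lambda>(a, b). (block P a, block P b)"])
  qed (auto simp: coverings_def arc_nestings_def op op' sub non_largest_less_block_max[OF assms])
qed

section \<open>Exchanging the right ends of two arcs\<close>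

text \<open>Away from \<open>p\<close> the sets have equal size, and exactly one of them contains
  \<open>p\<close>; so the sizes differ by one.\<close>

lemma even_card_flip:
  assumes "finite S" "finite S'" "bij_betw g (S - {p}) (S' - {p})" "p \<in> S \<longleftrightarrow> p \<notin> S'"
  shows "even (card S') \<longleftrightarrow> odd (card S)"
proof -
  have c: "card (S - {p}) = card (S' - {p})" using bij_betw_same_card[OF assms(3)] .
  show ?thesis
  proof (cases "p \<in> S")
    case True
    then have "card S = Suc (card (S - {p}))" "S' - {p} = S'"
      using assms(1,4) by (metis card.remove, simp)
    then have "card S = Suc (card S')" using c by metis
    then show ?thesis by simp
  next
    case False
    then have "card S' = Suc (card (S' - {p}))" "S - {p} = S"
      using assms(2,4) by (metis card.remove, simp)
    then have "card S' = Suc (card S)" using c by metis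
    then show ?thesis by simp
  qed
qed

text \<open>The arc of \<open>i\<close> passes over \<open>j\<close>, and the two arcs exchange
  right ends. By \<open>early\<close>, any other arc starting before \<open>j\<close> ends no later
  than \<open>i\<close>, so it crosses or encloses neither of the two.\<close>

locale arc_swap =
  fixes N :: "nat set" and r r' :: "nat \<Rightarrow> nat" and i j :: nat
  assumes fin: "finite N" and i: "i \<in> N" and j: "j \<in> N" and ij: "i < j" and jr: "j < r i"
    and up: "\<And>x. x \<in> N \<Longrightarrow> x < r x"
    and ne: "r i \<noteq> r j"
    and early: "\<And>x. x \<in> N \<Longrightarrow> x < j \<Longrightarrow> x \<noteq> i \<Longrightarrow> x < i \<and> r x \<le> i"
    and r'_i: "r' i = r j" and r'_j: "r' j = r i"
    and r'_eq: "\<And>x. x \<in> N \<Longrightarrow> x \<noteq> i \<Longrightarrow> x \<noteq> j \<Longrightarrow> r' x = r x"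
begin

text \<open>An arc followed along its right end moves its left end between \<open>i\<close> and
  \<open>j\<close>. Renaming the first component suffices because, apart from \<open>(i, j)\<close>
  itself, the second is never \<open>i\<close> or \<open>j\<close>.\<close>

abbreviation swap_first :: "nat \<times> nat \<Rightarrow> nat \<times> nat" where
  "swap_first \<equiv> \<lambda>(a, b). (transpose i j a, b)"

lemma late: "x \<in> N \<Longrightarrow> i < x \<Longrightarrow> x \<noteq> j \<Longrightarrow> j < x"
  using early[of x] by linarith

lemma crossings_image:
  "swap_first ` (arc_crossings N r K - {(i, j)}) \<subseteq> arc_crossings N r' K - {(i, j)}"
proof (rule image_subsetI)
  fix p assume p: "p \<in> arc_crossings N r K - {(i, j)}"
  obtain a b where [simp]: "p = (a, b)" by fastforce
  have ab: "(a, b) \<in> arc_crossings N r K" "(a, b) \<noteq> (i, j)" using p by auto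
  then have h: "a \<in> N" "b \<in> N" "b \<in> K" "a < b" "b < r a" "r a < r b" by (auto simp: arc_crossings_def)
  \<comment> \<open>For \<open>b = i\<close> or \<open>b = j\<close>, \<open>early\<close> would end
    the arc of \<open>a\<close> at or before \<open>i\<close>, yet it must pass over
    \<open>b\<close>; the exception \<open>a = i\<close>, \<open>b = j\<close> has been
    removed.\<close>
  have b: "b \<noteq> i" "b \<noteq> j" using h ab early[of a] ij by auto
  consider "a = i" | "a = j" | "a \<noteq> i" "a \<noteq> j" by blast
  then show "swap_first p \<in> arc_crossings N r' K - {(i, j)}"
  proof cases
    case 1
    \<comment> \<open>The arc now starting at \<open>j\<close> must still start before
      \<open>b\<close>.\<close>
    then have "j < b" using late h b by auto
    then show ?thesis using 1 h b j r'_j r'_eq by (auto simp: arc_crossings_def)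
  next
    case 2
    then show ?thesis using h b i ij r'_i r'_eq by (auto simp: arc_crossings_def)
  next
    case 3
    then show ?thesis using h b r'_eq by (auto simp: arc_crossings_def)
  qed
qed

lemma nestings_image:
  "swap_first ` (arc_nestings N r K - {(i, j)}) \<subseteq> arc_nestings N r' K - {(i, j)}"
proof (rule image_subsetI)
  fix p assume p: "p \<in> arc_nestings N r K - {(i, j)}"
  obtain a b where [simp]: "p = (a, b)" by fastforce
  have ab: "(a, b) \<in> arc_nestings N r K" "(a, b) \<noteq> (i, j)" using p by auto
  then have h: "a \<in> N" "b \<in> N" "b \<in> K" "a < b" "r b < r a" by (auto simp: arc_nestings_def)
  have b: "b \<noteq> i" "b \<noteq> j" using h ab early[of a] ij up[of i] up[of j] by auto
  consider "a = i" | "a = j" | "a \<noteq> i" "a \<noteq> j" by blast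
  then show "swap_first p \<in> arc_nestings N r' K - {(i, j)}"
  proof cases
    case 1
    then have "j < b" using late h b by auto
    then show ?thesis using 1 h b j r'_j r'_eq by (auto simp: arc_nestings_def)
  next
    case 2
    then show ?thesis using h b i ij r'_i r'_eq by (auto simp: arc_nestings_def)
  next
    case 3
    then show ?thesis using h b r'_eq by (auto simp: arc_nestings_def)
  qed
qed

text \<open>Both \<open>r i\<close> and \<open>r j\<close> exceed \<open>j\<close>, so the
  conditions survive the exchange. The image inclusions thus hold in both directions, and the
  self-inverse \<open>swap_first\<close> becomes a bijection.\<close>

lemma arc_swap_sym: "arc_swap N r' r i j"
proof
  show "j < r' i" using up[OF j] r'_i by simp
  show "r' i \<noteq> r' j" using ne r'_i r'_j by simp
  fix x assume x: "x \<in> N"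
  show "x < r' x" using up x r'_eq r'_i r'_j ij jr up[OF j] by (metis less_trans)
  assume "x < j" "x \<noteq> i"
  then show "x < i \<and> r' x \<le> i" using early x r'_eq by auto
qed (use fin i j ij r'_i r'_j r'_eq in auto)

lemma even_card_crossings:
  assumes "j \<in> K"
  shows "even (card (arc_crossings N r' K)) \<longleftrightarrow> odd (card (arc_crossings N r K))"
proof (rule even_card_flip)
  show "bij_betw swap_first (arc_crossings N r K - {(i, j)}) (arc_crossings N r' K - {(i, j)})"
    using crossings_image arc_swap.crossings_image[OF arc_swap_sym]
    by (intro bij_betw_byWitness[where f' = swap_first]) auto
  \<comment> \<open>The exchange reverses the order of the two right ends, so this pair crosses on
    exactly one side; \<open>j \<in> K\<close> makes it count.\<close>
  show "(i, j) \<in> arc_crossings N r K \<longleftrightarrow> (i, j) \<notin> arc_crossings N r' K"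
    using assms i j ij jr ne r'_i r'_j up[OF j] by (auto simp: arc_crossings_def)
qed (use finite_arcs fin in auto)

lemma even_card_nestings:
  assumes "j \<in> K"
  shows "even (card (arc_nestings N r' K)) \<longleftrightarrow> odd (card (arc_nestings N r K))"
proof (rule even_card_flip)
  show "bij_betw swap_first (arc_nestings N r K - {(i, j)}) (arc_nestings N r' K - {(i, j)})"
    using nestings_image arc_swap.nestings_image[OF arc_swap_sym]
    by (intro bij_betw_byWitness[where f' = swap_first]) auto
  show "(i, j) \<in> arc_nestings N r K \<longleftrightarrow> (i, j) \<notin> arc_nestings N r' K"
    using assms i j ij jr ne r'_i r'_j up[OF j] by (auto simp: arc_nestings_def)
qed (use finite_arcs fin in auto)

text \<open>\<open>swap_first\<close> keeps the second component, so a nested point other than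
  \<open>j\<close> still has an enclosing arc.\<close>

lemma nested_points_image:
  "nested_points N r K - {j} \<subseteq> nested_points N r' K - {j}"
proof -
  have "snd p \<in> snd ` (arc_nestings N r' K - {(i, j)})"
    if p: "p \<in> arc_nestings N r K - {(i, j)}" for p
  proof -
    have "swap_first p \<in> arc_nestings N r' K - {(i, j)}" using nestings_image p by blast
    moreover have "snd (swap_first p) = snd p" by (simp add: case_prod_beta)
    ultimately show ?thesis by (metis image_eqI)
  qed
  then show ?thesis unfolding nested_points_def by fastforce
qed

lemma even_card_nested_points:
  assumes "j \<in> K"
  shows "even (card (nested_points N r' K)) \<longleftrightarrow> odd (card (nested_points N r K))"
proof (rule even_card_flip)
  have "nested_points N r K - {j} = nested_points N r' K - {j}"
    using nested_points_image arc_swap.nested_points_image[OF arc_swap_sym] by blast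
  then show "bij_betw id (nested_points N r K - {j}) (nested_points N r' K - {j})" by auto
  \<comment> \<open>Any other arc starting before \<open>j\<close> also ends before
    \<open>j\<close>, so only the arc of \<open>i\<close> can enclose that of
    \<open>j\<close>.\<close>
  have "j \<in> nested_points N s K \<longleftrightarrow> s j < s i" if "arc_swap N s s' i j" for s s'
    using arc_swap.early[OF that] arc_swap.up[OF that, of j] assms i j ij
    unfolding nested_points_iff by force
  then show "j \<in> nested_points N r K \<longleftrightarrow> j \<notin> nested_points N r' K"
    using arc_swap_axioms arc_swap_sym ne r'_i r'_j by auto
qed (use finite_arcs fin in auto)

end

section \<open>Covered elements\<close>

text \<open>Only membership in blocks is used, not consecutive elements, so the notion serves right
  neighbours and block maxima alike.\<close>

definition covered :: "nat set set \<Rightarrow> nat \<Rightarrow> bool" where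
  "covered P j \<longleftrightarrow> (\<exists>A\<in>P. \<exists>B\<in>P. A \<noteq> B \<and> j \<in> B \<and> (\<exists>y\<in>B. j < y) \<and> (\<exists>x\<in>A. x < j) \<and> (\<exists>y\<in>A. j < y))"

definition uncovered_partition :: "nat set set \<Rightarrow> bool" where
  "uncovered_partition P \<longleftrightarrow> (\<forall>j. \<not> covered P j)"

lemma coveredI:
  assumes "A \<in> P" "B \<in> P" "A \<noteq> B" "j \<in> B" "y \<in> B" "j < y" "x \<in> A" "x < j" "z \<in> A" "j < z"
  shows "covered P j"
  using assms unfolding covered_def by blast

lemma non_largest_iff_block:
  assumes "partition_on X P" "finite X"
  shows "non_largest P x \<longleftrightarrow> (\<exists>C\<in>P. x \<in> C \<and> (\<exists>y\<in>C. x < y))"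
  using non_largest_iff[OF assms] block_mem[OF assms(1)] block_eq[OF assms(1)] block_subset[OF assms(1)]
  by metis

lemma opener_iff_block:
  assumes "partition_on X P" "finite X"
  shows "opener P x \<longleftrightarrow> (\<exists>C\<in>P. x \<in> C \<and> (\<exists>y\<in>C. x < y) \<and> (\<forall>y\<in>C. x \<le> y))"
  using opener_iff[OF assms] non_largest_iff_block[OF assms] block_eq[OF assms(1)] by metis

lemma right_neighbour_eqI:
  assumes "partition_on X P" "finite X" "C \<in> P" "x \<in> C" "y \<in> C" "x < y"
    "\<And>z. z \<in> C \<Longrightarrow> x < z \<Longrightarrow> y \<le> z"
  shows "right_neighbour P x = y"
proof -
  have nl: "non_largest P x" using non_largest_iff_block[OF assms(1,2)] assms by blast
  show ?thesis
    using right_neighbour[OF assms(1,2) nl] assms(5-7) block_eq[OF assms(1,3,4)] by (metis order_antisym)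
qed

text \<open>If \<open>a\<close> and \<open>b\<close> shared a block, the right neighbour of
  \<open>a\<close> would be at most \<open>b\<close>; so it is another block that passes over
  \<open>b\<close>.\<close>

lemma covered_of_arc:
  assumes "partition_on X P" "finite X" "non_largest P a" "non_largest P b"
    "a < b" "b < right_neighbour P a"
  shows "covered P b"
proof -
  note r = right_neighbour[OF assms(1-3)]
  note a = block_mem[OF assms(1) non_largest_mem[OF assms(1,3)]]
  obtain C y where "C \<in> P" "b \<in> C" "y \<in> C" "b < y" using non_largest_iff_block[OF assms(1,2)] assms(4) by blast
  moreover have "block P a \<noteq> C" using r(3)[of b] assms(5,6) \<open>b \<in> C\<close> by auto
  ultimately show ?thesis using coveredI[OF a(1)] a(2) r(1) assms(5,6) by blast
qed

lemma covered_of_block_max: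
  assumes "partition_on X P" "finite X" "a \<in> X" "non_largest P b"
    "a < b" "b < block_max P a" "block P a \<noteq> block P b"
  shows "covered P b"
proof -
  note a = block_mem[OF assms(1,3)] and m = block_max(1)[OF assms(1-3)]
  have b: "b \<in> X" using non_largest_mem[OF assms(1,4)] .
  then obtain y where "y \<in> block P b" "b < y" using non_largest_iff[OF assms(1,2)] assms(4) by blast
  then show ?thesis using coveredI[OF a(1) _ assms(7)] a m assms(5,6) block_mem[OF assms(1) b] by blast
qed

text \<open>In each such pair the second left end lies under the first arc, which belongs to another
  block, and is therefore covered.\<close>

lemma uncovered_arcs_empty:
  assumes P: "partition_on X P" "finite X" and u: "uncovered_partition P"
  shows "arc_crossings (non_largests P) (right_neighbour P) K = {}"
    "arc_nestings (non_largests P) (right_neighbour P) K = {}"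
    "arc_nestings (non_largests P) (block_max P) K = {}"
    "arc_crossings (openers P) (block_max P) K = {}"
    "arc_nestings (openers P) (block_max P) K = {}"
proof -
  have nc: "\<not> covered P x" for x using u by (simp add: uncovered_partition_def)
  have op: "opener P x \<Longrightarrow> non_largest P x" for x using opener_iff[OF P] by blast
  show "arc_crossings (non_largests P) (right_neighbour P) K = {}"
    using covered_of_arc[OF P] nc by (auto simp: arc_crossings_def)
  show "arc_nestings (non_largests P) (right_neighbour P) K = {}"
    using covered_of_arc[OF P] nc right_neighbour(2)[OF P] by (force simp: arc_nestings_def)
  show e: "arc_nestings (non_largests P) (block_max P) K = {}"
    using covered_of_block_max[OF P non_largest_mem[OF P(1)]] nc non_largest_less_block_max[OF P]
    by (force simp: arc_nestings_def)
  then show "arc_nestings (openers P) (block_max P) K = {}"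
    using op by (fastforce simp: arc_nestings_def)
  show "arc_crossings (openers P) (block_max P) K = {}"
    using covered_of_block_max[OF P non_largest_mem[OF P(1)]] nc op by (force simp: arc_crossings_def)
qed

text \<open>Fixing the witnesses \<open>A\<close> and \<open>B\<close> makes the swap an explicit
  expression; \<open>unique\<close> shows later that \<open>P\<close> determines them.\<close>

locale least_covered =
  fixes X :: "nat set" and P :: "nat set set" and j :: nat and A B :: "nat set"
  assumes part: "partition_on X P" and finX: "finite X"
    and A: "A \<in> P" and B: "B \<in> P" and AB: "A \<noteq> B" and jB: "j \<in> B"
    and B_hi: "\<exists>y\<in>B. j < y" and A_lo: "\<exists>x\<in>A. x < j" and A_hi: "\<exists>y\<in>A. j < y"
    and least: "\<And>z. z < j \<Longrightarrow> \<not> covered P z"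

text \<open>For a least covered \<open>j\<close>, \<open>insert j\<close> supplies the whole lower
  part of \<open>B\<close>, since \<open>j\<close> is then its minimum.\<close>

definition swap_tails :: "nat \<Rightarrow> nat set \<Rightarrow> nat set \<Rightarrow> nat set set \<Rightarrow> nat set set" where
  "swap_tails j A B P =
    insert ({x \<in> A. x < j} \<union> {x \<in> B. j < x}) (insert (insert j {x \<in> A. j < x}) (P - {A, B}))"

lemma least_covered_exists:
  assumes "partition_on X P" "finite X" "\<not> uncovered_partition P"
  shows "\<exists>j A B. least_covered X P j A B"
proof -
  define j where "j = (LEAST z. covered P z)"
  have "covered P j" unfolding j_def using assms(3) LeastI_ex uncovered_partition_def by metis
  moreover have "\<not> covered P z" if "z < j" for z using that not_less_Least j_def by blast
  moreover from calculation(1) obtain A B where "A \<in> P" "B \<in> P" "A \<noteq> B" "j \<in> B"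
    "\<exists>y\<in>B. j < y" "\<exists>x\<in>A. x < j" "\<exists>y\<in>A. j < y" unfolding covered_def by auto
  ultimately show ?thesis using least_covered.intro[OF assms(1,2)] by blast
qed

context least_covered
begin

section \<open>Structure at the least covered element\<close>

lemma disj: "x \<in> A \<Longrightarrow> x \<notin> B"
  using blocks_eq[OF part A B] AB by blast

lemma jA: "j \<notin> A"
  using disj jB by blast

text \<open>If \<open>B\<close> had an element below \<open>j\<close>, take one of \<open>A\<close>
  below \<open>j\<close> as well: the larger of the two would be covered by the block of the other,
  against minimality.\<close>

lemma B_min: "y \<in> B \<Longrightarrow> j \<le> y"
proof (rule ccontr)
  assume y: "y \<in> B" "\<not> j \<le> y"
  obtain x z where x: "x \<in> A" "x < j" "z \<in> A" "j < z" using A_lo A_hi by blast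
  have "x \<noteq> y" using disj x y by blast
  then consider "x < y" | "y < x" by linarith
  then show False
  proof cases
    case 1
    then have "covered P y" using coveredI[OF A B AB y(1) jB _ x(1) _ x(3)] y x by simp
    then show ?thesis using least y by simp
  next
    case 2
    then have "covered P x" using coveredI[OF B A _ x(1) x(3) _ y(1) _ jB] AB x by simp
    then show ?thesis using least x by simp
  qed
qed

text \<open>Two blocks passing over \<open>j\<close> each have an element below \<open>j\<close>,
  and the larger of these would be covered.\<close>

lemma A_unique:
  assumes "C \<in> P" "x \<in> C" "x < j" "y \<in> C" "j < y"
  shows "C = A"
proof (rule ccontr)
  assume C: "C \<noteq> A"
  obtain x' z where x': "x' \<in> A" "x' < j" "z \<in> A" "j < z" using A_lo A_hi by blast
  have "x \<noteq> x'" using blocks_eq[OF part A assms(1) x'(1)] assms(2) C by blast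
  then consider "x < x'" | "x' < x" by linarith
  then show False
  proof cases
    case 1
    then have "covered P x'" using coveredI[OF assms(1) A C x'(1) x'(3) _ assms(2) _ assms(4)] assms x' by simp
    then show ?thesis using least x' by simp
  next
    case 2
    then have "covered P x" using coveredI[OF A assms(1) _ assms(2,4) _ x'(1) _ x'(3)] C assms x' by simp
    then show ?thesis using least assms by simp
  qed
qed

section \<open>The tail swap as an involution\<close>

abbreviation (input) A' :: "nat set" where "A' \<equiv> {x \<in> A. x < j} \<union> {x \<in> B. j < x}"
abbreviation (input) B' :: "nat set" where "B' \<equiv> insert j {x \<in> A. j < x}"
abbreviation (input) P' :: "nat set set" where "P' \<equiv> swap_tails j A B P"

lemma mem_swap: "C \<in> P' \<longleftrightarrow> C = A' \<or> C = B' \<or> C \<in> P \<and> C \<noteq> A \<and> C \<noteq> B"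
  unfolding swap_tails_def by blast

lemma Union_tails: "A' \<union> B' = A \<union> B"
proof -
  have "x < j \<or> j < x" if "x \<in> A" for x using jA that by (metis linorder_neqE_nat)
  moreover have "x = j \<or> j < x" if "x \<in> B" for x using B_min[OF that] by linarith
  ultimately show ?thesis using jB by blast
qed

lemma tails_disjoint: "A' \<inter> B' = {}"
  using disj by auto

lemma swap_partition: "partition_on X P'"
proof (rule partition_onI)
  have "\<Union> P' = (A' \<union> B') \<union> \<Union> (P - {A, B})" unfolding swap_tails_def by blast
  also have "\<dots> = \<Union> P" unfolding Union_tails using A B by blast
  finally show "\<Union> P' = X" using partition_onD1[OF part] by simp
  have "{} \<notin> P" using partition_onD3[OF part] .
  then show "{} \<notin> P'" using A_lo unfolding mem_swap by blast
  have o: "C \<inter> A' = {} \<and> C \<inter> B' = {}" if "C \<in> P" "C \<noteq> A" "C \<noteq> B" for C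
  proof -
    have "C \<inter> (A \<union> B) = {}"
      using blocks_eq[OF part that(1) A] blocks_eq[OF part that(1) B] that(2,3) by blast
    then show ?thesis unfolding Union_tails[symmetric] Int_Un_distrib Un_empty .
  qed
  have "disjnt C D" if "a \<inter> b = {}" "\<And>E. E \<in> Q \<Longrightarrow> E \<inter> a = {} \<and> E \<inter> b = {}"
    "\<And>E F. E \<in> Q \<Longrightarrow> F \<in> Q \<Longrightarrow> E \<noteq> F \<Longrightarrow> E \<inter> F = {}"
    "C \<in> insert a (insert b Q)" "D \<in> insert a (insert b Q)" "C \<noteq> D" for a b C D :: "nat set" and Q
    using that(4-6) that(1) that(2)[of C] that(2)[of D] that(3)[of C D]
    unfolding disjnt_def insert_iff by (elim disjE) auto
  note disjnt = this
  show "disjnt C D" if "C \<in> P'" "D \<in> P'" "C \<noteq> D" for C D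
  proof (rule disjnt[OF tails_disjoint _ _ that[unfolded swap_tails_def]])
    show "E \<inter> A' = {} \<and> E \<inter> B' = {}" if "E \<in> P - {A, B}" for E using o that by simp
    show "E \<inter> F = {}" if "E \<in> P - {A, B}" "F \<in> P - {A, B}" "E \<noteq> F" for E F
      using that blocks_eq[OF part] by blast
  qed
qed

text \<open>Below \<open>j\<close> the blocks of \<open>P'\<close> agree with those of
  \<open>P\<close> once \<open>A'\<close> is read as \<open>A\<close>, and both reach beyond
  \<open>j\<close>. So witnesses in \<open>P'\<close> yield witnesses in \<open>P\<close>, possibly
  with other upper elements.\<close>

lemma swap_uncovered:
  assumes z: "z < j"
  shows "\<not> covered P' z"
proof
  assume "covered P' z"
  then obtain C D x y w where h: "C \<in> P'" "D \<in> P'" "C \<noteq> D" "z \<in> D" "y \<in> D" "z < y" "x \<in> C" "x < z" "w \<in> C" "z < w"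
    unfolding covered_def by blast
  obtain C' w' where C': "C' \<in> P" "x \<in> C'" "w' \<in> C'" "z < w'" "C = A' \<longleftrightarrow> C' = A" "C \<noteq> A' \<longrightarrow> C' = C"
  proof (cases "C = A'")
    case True
    then have "x \<in> A" using h z by auto
    moreover obtain v where "v \<in> A" "z < v" using A_hi z by (meson less_trans)
    ultimately show ?thesis using that[of A v] A True by blast
  next
    case False
    \<comment> \<open>\<open>C\<close> has an element below \<open>j\<close>, whereas
      \<open>B'\<close> starts at \<open>j\<close>.\<close>
    have "C \<noteq> B'" using h z by auto
    then have "C \<in> P" "C \<noteq> A" using False mem_swap[THEN iffD1, OF h(1)] by simp_all
    then show ?thesis using that[of C w] False h by simp
  qed
  obtain D' y' where D': "D' \<in> P" "z \<in> D'" "y' \<in> D'" "z < y'" "D = A' \<longleftrightarrow> D' = A" "D \<noteq> A' \<longrightarrow> D' = D"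
  proof (cases "D = A'")
    case True
    then have "z \<in> A" using h z by auto
    moreover obtain v where "v \<in> A" "z < v" using A_hi z by (meson less_trans)
    ultimately show ?thesis using that[of A v] A True by blast
  next
    case False
    have "D \<noteq> B'" using h z by auto
    then have "D \<in> P" "D \<noteq> A" using False mem_swap[THEN iffD1, OF h(2)] by simp_all
    then show ?thesis using that[of D y] False h by simp
  qed
  have "C' \<noteq> D'" using C'(5,6) D'(5,6) h(3) by metis
  from coveredI[OF C'(1) D'(1) this D'(2-4) C'(2) h(8) C'(3,4)] show False using least z by blast
qed

text \<open>The configuration recurs in \<open>P'\<close>, so facts shown for \<open>P\<close> apply
  to \<open>P'\<close>; together with \<open>swap_swap\<close> this turns implications into
  equivalences.\<close>

lemma swap_least_covered: "least_covered X P' j A' B'"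
proof
  show "A' \<in> P'" "B' \<in> P'" by (auto simp: swap_tails_def)
  show "A' \<noteq> B'" using A_lo by auto
qed (use swap_partition finX B_hi A_lo A_hi swap_uncovered in auto)

lemma tails_notin: "A' \<notin> P - {A, B}" "B' \<notin> P - {A, B}"
proof -
  show "A' \<notin> P - {A, B}" using A_lo blocks_eq[OF part _ A] by blast
  show "B' \<notin> P - {A, B}" using jB blocks_eq[OF part _ B] by blast
qed

lemma swap_swap: "swap_tails j A' B' P' = P"
proof -
  have a: "{x \<in> A'. x < j} \<union> {x \<in> B'. j < x} = A" "insert j {x \<in> A'. j < x} = B"
    using jA jB B_min by (auto simp: order_le_less) (metis linorder_neqE_nat)+
  have "swap_tails j A' B' P' = insert A (insert B (P' - {A', B'}))"
    unfolding swap_tails_def[of j A' B' P'] a ..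
  \<comment> \<open>The new blocks are not among the untouched ones, so removing them undoes exactly
    their insertion.\<close>
  also have "P' - {A', B'} = P - {A, B}"
  proof -
    have "insert C (insert D Q) - {C, D} = Q" if "C \<notin> Q" "D \<notin> Q" for C D :: "nat set" and Q
      using that by blast
    from this[OF tails_notin] show ?thesis unfolding swap_tails_def .
  qed
  also have "insert A (insert B (P - {A, B})) = P" using A B by blast
  finally show ?thesis .
qed

text \<open>Minimality fixes \<open>j\<close>, \<open>A_unique\<close> the straddling block, and
  disjointness the block of \<open>j\<close>.\<close>

lemma unique:
  assumes "least_covered X P k C D"
  shows "k = j" "C = A" "D = B"
proof -
  interpret o: least_covered X P k C D by fact
  have "covered P j" "covered P k"
    unfolding covered_def using A B AB jB B_hi A_lo A_hi o.A o.B o.AB o.jB o.B_hi o.A_lo o.A_hi by blast+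
  then show k: "k = j" using least[of k] o.least[of j] by (metis linorder_neqE_nat)
  show "C = A" using A_unique o.A o.A_lo o.A_hi k by blast
  show "D = B" using blocks_eq[OF part o.B B] o.jB jB k by blast
qed

end

section \<open>Parity of the statistics under the tail swap\<close>

abbreviation csp_statistics :: "(nat set set \<Rightarrow> nat) set" where
  "csp_statistics \<equiv> {num_non_exclusive_records, num_non_exclusive_record_openers, num_crossings,
    num_nestings, num_opener_crossings, num_opener_nestings, num_non_block_records,
    num_non_block_record_openers, num_overlaps, num_coverings}"

context least_covered
begin

lemmas block_finite' = block_finite[OF part finX]

text \<open>Both lower parts are joined to nonempty tails, and each tail moves as a whole, so no
  element becomes the largest of its block.\<close>

lemma non_largest_swap_imp: "non_largest P x \<Longrightarrow> non_largest P' x"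
proof -
  assume "non_largest P x"
  then obtain C y where C: "C \<in> P" "x \<in> C" "y \<in> C" "x < y"
    using non_largest_iff_block[OF part finX] by blast
  obtain a b where ab: "a \<in> A" "j < a" "b \<in> B" "j < b" using A_hi B_hi by blast
  have "\<exists>C\<in>P'. x \<in> C \<and> (\<exists>y\<in>C. x < y)"
  proof -
    consider "C \<noteq> A" "C \<noteq> B" | "C = A" "x < j" | "C = A" "j < x" | "C = B" "x = j" | "C = B" "j < x"
      using B_min jA C by (metis linorder_neqE_nat order_le_less)
    then show ?thesis
    proof cases
      case 1 then show ?thesis using C by (auto simp: swap_tails_def)
    next
      case 2 then show ?thesis using C ab by (intro bexI[of _ A'] conjI bexI[of _ b]) (auto simp: swap_tails_def)
    next
      case 3 then show ?thesis using C by (intro bexI[of _ B']) (auto simp: swap_tails_def)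
    next
      case 4 then show ?thesis using ab by (intro bexI[of _ B']) (auto simp: swap_tails_def)
    next
      case 5 then show ?thesis using C by (intro bexI[of _ A']) (auto simp: swap_tails_def)
    qed
  qed
  then show ?thesis using non_largest_iff_block[OF swap_partition finX] by blast
qed

lemma non_largest_swap: "non_largest P' x \<longleftrightarrow> non_largest P x"
  using non_largest_swap_imp least_covered.non_largest_swap_imp[OF swap_least_covered]
  unfolding swap_swap by blast

lemma opener_swap_imp: "opener P x \<Longrightarrow> opener P' x"
proof -
  assume o: "opener P x"
  then obtain C where C: "C \<in> P" "x \<in> C" "\<forall>y\<in>C. x \<le> y"
    using opener_iff_block[OF part finX] by blast
  have "\<exists>D\<in>P'. x \<in> D \<and> (\<forall>y\<in>D. x \<le> y)"
  proof -
    consider "C \<noteq> A" "C \<noteq> B" | "C = A" "x < j" | "C = B" "x = j"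
      using B_min jB A_lo C by (metis order_antisym order_le_less_trans)
    then show ?thesis
    proof cases
      case 1 then show ?thesis using C by (auto simp: swap_tails_def)
    next
      case 2 then show ?thesis using C by (intro bexI[of _ A']) (auto simp: swap_tails_def)
    next
      case 3 then show ?thesis by (intro bexI[of _ B']) (auto simp: swap_tails_def)
    qed
  qed
  moreover have "non_largest P' x" using o non_largest_swap opener_iff[OF part finX] by blast
  ultimately show ?thesis using opener_iff[OF swap_partition finX] block_eq[OF swap_partition] by metis
qed

lemma opener_swap: "opener P' x \<longleftrightarrow> opener P x"
  using opener_swap_imp least_covered.opener_swap_imp[OF swap_least_covered]
  unfolding swap_swap by blast

text \<open>The arc leaving this element is the one of \<open>A\<close> that passes over
  \<open>j\<close>.\<close>

definition i :: nat where "i = Max {x \<in> A. x < j}"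

section \<open>Effect of the swap on right neighbours\<close>

lemma i: "i \<in> A" "i < j" "\<And>x. x \<in> A \<Longrightarrow> x < j \<Longrightarrow> x \<le> i"
proof -
  have f: "finite {x \<in> A. x < j}" using block_finite'[OF A] by simp
  have ne: "{x \<in> A. x < j} \<noteq> {}" using A_lo by blast
  show "i \<in> A" "i < j" using Max_in[OF f ne] unfolding i_def by auto
  show "\<And>x. x \<in> A \<Longrightarrow> x < j \<Longrightarrow> x \<le> i" using Max_ge[OF f] unfolding i_def by simp
qed

lemma non_largest_i: "non_largest P i"
  using non_largest_iff_block[OF part finX] i A A_hi by (meson less_trans)

lemma non_largest_j: "non_largest P j"
  using non_largest_iff_block[OF part finX] jB B B_hi by blast

lemma opener_j: "opener P j"
  using opener_iff_block[OF part finX] jB B B_hi B_min by blast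

lemma block_i: "block P i = A" and block_j: "block P j = B"
  using block_eq[OF part] A B i jB by auto

lemma right_neighbour_i: "right_neighbour P i \<in> A" "j < right_neighbour P i"
proof -
  note r = right_neighbour[OF part finX non_largest_i, unfolded block_i]
  show "right_neighbour P i \<in> A" using r by blast
  have "\<not> right_neighbour P i < j" using i(3)[of "right_neighbour P i"] r by auto
  moreover have "right_neighbour P i \<noteq> j" using r(1) jA by metis
  ultimately show "j < right_neighbour P i" by simp
qed

lemma tails_mem: "A' \<in> P'" "B' \<in> P'"
  by (auto simp: swap_tails_def)

lemma right_neighbour_swap_j: "right_neighbour P' j = right_neighbour P i"
  using right_neighbour_i right_neighbour(3)[OF part finX non_largest_i, unfolded block_i] i
  by (intro right_neighbour_eqI[OF swap_partition finX tails_mem(2)]) auto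

lemma right_neighbour_swap_i: "right_neighbour P' i = right_neighbour P j"
proof -
  note r = right_neighbour[OF part finX non_largest_j, unfolded block_j]
  show ?thesis
    using r i by (intro right_neighbour_eqI[OF swap_partition finX tails_mem(1)]) (auto dest: leD)
qed

lemma right_neighbour_swap:
  assumes "non_largest P x" "x \<noteq> i" "x \<noteq> j"
  shows "right_neighbour P' x = right_neighbour P x"
proof -
  note r = right_neighbour[OF part finX assms(1)]
  have x: "x \<in> X" using non_largest_mem[OF part assms(1)] .
  define C where "C = block P x"
  have C: "C \<in> P" "x \<in> C" using block_mem[OF part x] C_def by auto
  note r = r[folded C_def]
  consider "C \<noteq> A" "C \<noteq> B" | "C = A" "x < j" | "C = A" "j < x" | "C = B" "j < x"
    using B_min jA C assms by (metis linorder_neqE_nat order_le_less)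
  then show ?thesis
  proof cases
    case 1
    then show ?thesis using C r
      by (intro right_neighbour_eqI[OF swap_partition finX, of C]) (auto simp: swap_tails_def)
  next
    case 2
    \<comment> \<open>\<open>x\<close> is in the lower part of \<open>A\<close> but not last there,
      so its right neighbour stays in that part.\<close>
    then have "x < i" using i(3)[of x] C assms by simp
    then have "right_neighbour P x \<le> i" using r(3)[of i] i 2 by simp
    then show ?thesis using C r i 2
      by (intro right_neighbour_eqI[OF swap_partition finX tails_mem(1)]) auto
  next
    case 3
    then show ?thesis using C r
      by (intro right_neighbour_eqI[OF swap_partition finX tails_mem(2)]) auto
  next
    case 4
    then show ?thesis using C r
      by (intro right_neighbour_eqI[OF swap_partition finX tails_mem(1)]) auto
  qed
qed

lemma neighbours_arc_swap:
  "arc_swap (non_largests P) (right_neighbour P) (right_neighbour P') i j"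
proof
  have "non_largests P \<subseteq> X" using non_largest_mem[OF part] by blast
  then show "finite (non_largests P)" using finX finite_subset by blast
  show "right_neighbour P i \<noteq> right_neighbour P j"
    using inj_on_right_neighbour[OF part finX] non_largest_i non_largest_j i by (auto dest: inj_onD)
  fix x assume x: "x \<in> non_largests P"
  show "x < right_neighbour P x" using right_neighbour[OF part finX] x by simp
  assume xj: "x < j" "x \<noteq> i"
  show "x < i \<and> right_neighbour P x \<le> i"
  proof
    \<comment> \<open>A non-largest element between \<open>i\<close> and \<open>j\<close> would lie
      under the arc of \<open>i\<close>, hence be covered before \<open>j\<close>.\<close>
    show "x < i"
      using covered_of_arc[OF part finX non_largest_i, of x] x xj least[of x] right_neighbour_i
      by (metis less_trans linorder_neqE_nat mem_Collect_eq)
    \<comment> \<open>Otherwise the arc of \<open>x\<close> would pass over \<open>i\<close>, making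
      \<open>i\<close> covered although \<open>i < j\<close>.\<close>
    then show "right_neighbour P x \<le> i"
      using covered_of_arc[OF part finX _ non_largest_i, of x] x least[OF i(2)] by fastforce
  qed
qed (use non_largest_i non_largest_j i right_neighbour_i right_neighbour_swap right_neighbour_swap_i
      right_neighbour_swap_j in auto)

section \<open>Effect of the swap on block maxima\<close>

lemma Min_A: "Min A \<in> A" "Min A < j" "opener P (Min A)" "block P (Min A) = A"
proof -
  have f: "finite A" using block_finite'[OF A] .
  show m: "Min A \<in> A" using Min_in[OF f] i by blast
  show mj: "Min A < j" using Min_le[OF f i(1)] i(2) by simp
  show "opener P (Min A)"
    using opener_iff_block[OF part finX] A m mj A_hi f by (metis Min_le less_trans)
  show "block P (Min A) = A" using block_eq[OF part A m] .
qed

lemma Max_swap: "Max A' = Max B" "Max B' = Max A"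
proof -
  have f: "finite A" "finite B" using block_finite' A B by auto
  \<comment> \<open>Both tails are nonempty, so each maximum lies in a tail and moves with
    it.\<close>
  have m: "Max A \<in> A" "Max B \<in> B" "j < Max A" "j < Max B"
    using Max_in[OF f(1)] Max_in[OF f(2)] A_hi B_hi Max_ge[OF f(1)] Max_ge[OF f(2)]
    by (blast, blast, meson less_le_trans, meson less_le_trans)
  show "Max A' = Max B" using f m by (intro Max_eqI) auto
  show "Max B' = Max A" using f m by (intro Max_eqI) auto
qed

lemma Max_neq: "Max A \<noteq> Max B"
  using block_max(1)[OF part finX, of i] block_max(1)[OF part finX, of j] disj
    block_subset[OF part A i(1)] block_subset[OF part B jB]
  unfolding block_i block_j by metis

lemma block_swap:
  shows "x \<in> X \<Longrightarrow> x \<notin> A \<Longrightarrow> x \<notin> B \<Longrightarrow> block P' x = block P x"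
    and "x \<in> A \<Longrightarrow> x < j \<Longrightarrow> block P' x = A'"
    and "x \<in> B \<Longrightarrow> j < x \<Longrightarrow> block P' x = A'"
    and "x \<in> A \<Longrightarrow> j < x \<Longrightarrow> block P' x = B'"
    and "block P' j = B'"
proof -
  assume x: "x \<in> X" "x \<notin> A" "x \<notin> B"
  then have "block P x \<in> P'" using block_mem[OF part x(1)] by (auto simp: swap_tails_def)
  then show "block P' x = block P x" using block_eq[OF swap_partition] block_mem[OF part x(1)] by blast
qed (use tails_mem in \<open>auto intro!: block_eq[OF swap_partition]\<close>)

text \<open>The arc from \<open>Min A\<close> to \<open>Max A\<close> passes over \<open>j\<close>,
  and swapping tails exchanges the two maxima. As for right neighbours, \<open>early\<close> holds
  because nothing before \<open>j\<close> is covered.\<close>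

lemma blocks_arc_swap:
  "arc_swap (openers P) (block_max P) (block_max P') (Min A) j"
proof
  have sub: "openers P \<subseteq> X" using opener_iff[OF part finX] non_largest_mem[OF part] by blast
  then show "finite (openers P)" using finX finite_subset by blast
  have jA: "j < Max A" using right_neighbour_i Max_ge[OF block_finite'[OF A]] by (meson less_le_trans)
  show "j < block_max P (Min A)" "block_max P (Min A) \<noteq> block_max P j"
    "block_max P' (Min A) = block_max P j" "block_max P' j = block_max P (Min A)"
    using jA Max_neq block_swap Max_swap Min_A by (auto simp: block_j)
  fix x assume "x \<in> openers P"
  then have x: "opener P x" "non_largest P x" "x \<in> X" using sub opener_iff[OF part finX] by auto
  show "x < block_max P x" using non_largest_less_block_max[OF part finX x(2)] .
  note b = block_mem[OF part x(3)]
  have m: "x = Min (block P x)" using x(1) by (simp add: opener_def)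
  \<comment> \<open>Such an opener is the minimum of a third block, which the swap leaves
    alone.\<close>
  show "block_max P' x = block_max P x" if "x \<noteq> Min A" "x \<noteq> j"
  proof -
    have "x \<notin> A" using block_eq[OF part A] m that by metis
    moreover have "x \<notin> B"
      using block_eq[OF part B, of x] m that block_eq[OF part B jB] opener_j by (metis opener_def)
    ultimately show ?thesis using block_swap(1) x by simp
  qed
  assume xj: "x < j" "x \<noteq> Min A"
  have nA: "block P x \<noteq> A" using m xj by auto
  have mA: "Min A \<in> X" "non_largest P (Min A)"
    using block_subset[OF part A Min_A(1)] opener_iff[OF part finX] Min_A(3) by auto
  show "x < Min A \<and> block_max P x \<le> Min A"
  proof
    show "x < Min A"
    proof (rule ccontr)
      assume "\<not> x < Min A"
      then have "covered P x"
        using xj jA nA Min_A(4) by (intro covered_of_block_max[OF part finX mA(1) x(2)]) auto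
      then show False using least xj by blast
    qed
    then have "covered P (Min A)" if "Min A < block_max P x"
      using that nA Min_A(4) by (intro covered_of_block_max[OF part finX x(3) mA(2)]) auto
    then show "block_max P x \<le> Min A" using least Min_A(2) by (meson not_le)
  qed
qed (use Min_A opener_j in auto)

text \<open>All elements of \<open>A\<close> below \<open>j\<close> change their block maximum, so
  this mixed count is no exchange of just two right ends. Nested points are followed directly: one
  other than \<open>j\<close> is covered, hence lies beyond \<open>j\<close>, where block maxima are
  kept.\<close>

lemma nested_block_max_image:
  assumes "x \<in> nested_points (non_largests P) (block_max P) UNIV" "x \<noteq> j"
  shows "x \<in> nested_points (non_largests P') (block_max P') UNIV"
proof -
  obtain a where a: "non_largest P x" "non_largest P a" "a < x" "block_max P x < block_max P a"
    using assms(1) unfolding nested_points_iff by blast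
  have X: "a \<in> X" "x \<in> X" using a non_largest_mem[OF part] by auto
  have "x < block_max P a" using non_largest_less_block_max[OF part finX a(1)] a(4) by simp
  then have "covered P x" using a by (intro covered_of_block_max[OF part finX X(1) a(1)]) auto
  then have x: "j < x" using least assms(2) by (metis linorder_neqE_nat)
  have "block_max P' x = block_max P x"
    using X x block_swap Max_swap block_eq[OF part A] block_eq[OF part B] by metis
  \<comment> \<open>The enclosing element is traded for one below \<open>x\<close> that has its old
    block maximum after the swap: \<open>j\<close> if it was in \<open>A\<close>, \<open>i\<close>
    if it was in \<open>B\<close>.\<close>
  moreover have "\<exists>b. non_largest P b \<and> b < x \<and> block_max P' b = block_max P a"
  proof -
    consider "a \<in> A" | "a \<in> B" | "a \<notin> A" "a \<notin> B" by blast
    then show ?thesis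
    proof cases
      case 1
      then show ?thesis
        using x non_largest_j block_swap(5) Max_swap block_eq[OF part A] by metis
    next
      case 2
      then show ?thesis
        using x i non_largest_i block_swap(2) Max_swap block_eq[OF part B] by (metis less_trans)
    next
      case 3
      then show ?thesis using block_swap(1) X a by metis
    qed
  qed
  ultimately show ?thesis using a unfolding nested_points_iff non_largest_swap by auto
qed

text \<open>An earlier element with a larger block maximum lies in a block passing over
  \<open>j\<close>, and \<open>A\<close> is the only one.\<close>

lemma j_nested_block_max:
  "j \<in> nested_points (non_largests P) (block_max P) UNIV \<longleftrightarrow> Max B < Max A"
proof
  assume "j \<in> nested_points (non_largests P) (block_max P) UNIV"
  then obtain a where a: "non_largest P a" "a < j" "Max B < block_max P a"
    unfolding nested_points_iff block_j by blast
  have X: "a \<in> X" using a non_largest_mem[OF part] by auto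
  have "j < block_max P a" using a(3) block_max(2)[OF part finX, of j] jB block_j
      block_subset[OF part B jB] by force
  then have "block P a = A"
    using A_unique block_mem[OF part X] a(2) block_max(1)[OF part finX X] by blast
  then show "Max B < Max A" using a by simp
next
  assume "Max B < Max A"
  then show "j \<in> nested_points (non_largests P) (block_max P) UNIV"
    using non_largest_i non_largest_j i block_i block_j unfolding nested_points_iff by auto
qed

lemma even_card_nested_block_max:
  "even (card (nested_points (non_largests P') (block_max P') UNIV)) \<longleftrightarrow>
    odd (card (nested_points (non_largests P) (block_max P) UNIV))"
proof (rule even_card_flip)
  interpret s: least_covered X P' j A' B' by (rule swap_least_covered)
  have f: "finite (non_largests Q)" if "partition_on X Q" for Q
    using non_largest_mem[OF that] finX by (metis finite_subset mem_Collect_eq subsetI)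
  show "finite (nested_points (non_largests P) (block_max P) UNIV)"
    "finite (nested_points (non_largests P') (block_max P') UNIV)"
    using finite_arcs(3) f part swap_partition by auto
  have "nested_points (non_largests P) (block_max P) UNIV - {j} =
      nested_points (non_largests P') (block_max P') UNIV - {j}"
    using nested_block_max_image s.nested_block_max_image unfolding swap_swap by blast
  then show "bij_betw id (nested_points (non_largests P) (block_max P) UNIV - {j})
      (nested_points (non_largests P') (block_max P') UNIV - {j})" by auto
  show "j \<in> nested_points (non_largests P) (block_max P) UNIV \<longleftrightarrow>
      j \<notin> nested_points (non_largests P') (block_max P') UNIV"
    using j_nested_block_max s.j_nested_block_max Max_swap Max_neq by auto
qed

lemma swap_flips:
  assumes "stat \<in> csp_statistics"
  shows "even (stat P') \<longleftrightarrow> odd (stat P)"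
proof -
  \<comment> \<open>All statistics but the mixed one are exchanges in one of the two arc systems,
    with filter \<open>UNIV\<close> or the openers; both contain \<open>j\<close>.\<close>
  interpret n: arc_swap "non_largests P" "right_neighbour P" "right_neighbour P'" i j
    by (rule neighbours_arc_swap)
  interpret b: arc_swap "openers P" "block_max P" "block_max P'" "Min A" j
    by (rule blocks_arc_swap)
  note flips = n.even_card_nested_points n.even_card_crossings n.even_card_nestings
    b.even_card_nested_points b.even_card_crossings b.even_card_nestings
    even_card_nested_block_max[unfolded non_largest_swap]
  have "j \<in> openers P" using opener_j by simp
  with assms show ?thesis
    by (auto simp: stats_eq[OF part finX] stats_eq[OF swap_partition finX] flips
        non_largest_swap opener_swap)
qed

end

section \<open>Counting partitions without covered elements\<close>

text \<open>The ground set is arbitrary because deleting a singleton block can leave a gap.\<close>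

definition uncovered_partitions :: "nat set \<Rightarrow> nat set set set" where
  "uncovered_partitions X = {P. partition_on X P \<and> uncovered_partition P}"

lemma finite_uncovered_partitions: "finite X \<Longrightarrow> finite (uncovered_partitions X)"
  unfolding uncovered_partitions_def
  by (rule finite_subset[OF _ finitely_many_partition_on]) auto

text \<open>Both blocks witnessing a covered element have at least two elements.\<close>

lemma covered_insert_singleton: "covered (insert {s} P) j \<longleftrightarrow> covered P j"
proof
  assume "covered (insert {s} P) j"
  then obtain A B where "A \<in> insert {s} P" "B \<in> insert {s} P" "A \<noteq> B" "j \<in> B" "\<exists>y\<in>B. j < y"
    "\<exists>x\<in>A. x < j" "\<exists>y\<in>A. j < y" unfolding covered_def by blast
  moreover from this have "A \<noteq> {s}" "B \<noteq> {s}" by auto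
  ultimately show "covered P j" unfolding covered_def by blast
next
  show "covered P j \<Longrightarrow> covered (insert {s} P) j" unfolding covered_def by blast
qed

lemma partition_on_remove_block:
  assumes "partition_on X P" "p \<in> P"
  shows "partition_on (X - p) (P - {p})"
proof -
  have "disjnt p (\<Union>(P - {p}))"
    using partition_onD2[OF assms(1)] assms(2) by (auto simp: disjnt_def disjoint_def)
  moreover have "insert p (P - {p}) = P" using assms(2) by blast
  ultimately show ?thesis using partition_on_insert[of p "P - {p}" X] assms(1) by simp
qed

text \<open>\<open>R\<close> is a side condition blind to the block \<open>{s}\<close>; it allows
  demanding at the same time that another singleton be absent.\<close>

lemma card_singleton_block:
  assumes "s \<in> X" "\<And>Q. R (insert {s} Q) \<longleftrightarrow> R Q"
  shows "card {P \<in> uncovered_partitions X. {s} \<in> P \<and> R P} =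
    card {Q \<in> uncovered_partitions (X - {s}). R Q}"
proof (rule bij_betw_same_card[symmetric])
  have unc: "uncovered_partition (insert {s} Q) \<longleftrightarrow> uncovered_partition Q" for Q
    by (simp add: uncovered_partition_def covered_insert_singleton)
  have s: "{s} \<notin> Q" "s \<notin> \<Union>Q" if "partition_on (X - {s}) Q" for Q
    using partition_onD1[OF that] by blast+
  have ins: "insert {s} (P - {{s}}) = P" if "{s} \<in> P" for P using that by blast
  have add: "partition_on X (insert {s} Q)" if "partition_on (X - {s}) Q" for Q
    using that assms(1) s[OF that] by (subst partition_on_insert) auto
  show "bij_betw (insert {s}) {Q \<in> uncovered_partitions (X - {s}). R Q}
      {P \<in> uncovered_partitions X. {s} \<in> P \<and> R P}"
  proof (rule bij_betw_byWitness[where f' = "\<lambda>P. P - {{s}}"])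
    show "(\<lambda>P. P - {{s}}) ` {P \<in> uncovered_partitions X. {s} \<in> P \<and> R P}
        \<subseteq> {Q \<in> uncovered_partitions (X - {s}). R Q}"
    proof (rule image_subsetI)
      fix P assume "P \<in> {P \<in> uncovered_partitions X. {s} \<in> P \<and> R P}"
      then have P: "partition_on X P" "uncovered_partition P" "{s} \<in> P" "R P"
        by (auto simp: uncovered_partitions_def)
      then show "P - {{s}} \<in> {Q \<in> uncovered_partitions (X - {s}). R Q}"
        using partition_on_remove_block[OF P(1,3)] unc[of "P - {{s}}"] assms(2)[of "P - {{s}}"] ins
        by (simp add: uncovered_partitions_def)
    qed
  qed (use s add unc assms(2) ins in \<open>auto simp: uncovered_partitions_def\<close>)
qed

text \<open>Being covered depends only on the order of elements, so increasing relabellings preserve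
  and reflect it. An increasing inverse then gives the other inequality.\<close>

lemma card_uncovered_strict_mono_le:
  assumes f: "strict_mono_on X f" and X: "finite X"
  shows "card (uncovered_partitions X) \<le> card (uncovered_partitions (f ` X))"
proof (rule card_inj_on_le)
  have inj: "inj_on f X" using f strict_mono_on_imp_inj_on by blast
  have less: "f x < f y \<longleftrightarrow> x < y" if "x \<in> X" "y \<in> X" for x y
    using f that by (rule strict_mono_on_less)
  show "inj_on ((`) ((`) f)) (uncovered_partitions X)"
  proof (rule inj_onI)
    fix P Q assume "P \<in> uncovered_partitions X" "Q \<in> uncovered_partitions X"
      and e: "(`) f ` P = (`) f ` Q"
    then have "P \<subseteq> Pow X" "Q \<subseteq> Pow X"
      by (auto simp: uncovered_partitions_def partition_on_def)
    from inj_on_image_eq_iff[OF inj_on_image_Pow[OF inj] this] show "P = Q" using e by simp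
  qed
  show "(`) ((`) f) ` uncovered_partitions X \<subseteq> uncovered_partitions (f ` X)"
  proof (rule image_subsetI)
    fix P assume "P \<in> uncovered_partitions X"
    then have P: "partition_on X P" and u: "\<And>j. \<not> covered P j"
      by (auto simp: uncovered_partitions_def uncovered_partition_def)
    have sub: "x \<in> X" if "C \<in> P" "x \<in> C" for C x using partition_onD1[OF P] that by blast
    have "partition_on (f ` X) ((`) f ` P - {{}})" using partition_on_inj_image[OF P inj] .
    moreover have "{} \<notin> (`) f ` P" using partition_onD3[OF P] by auto
    ultimately have "partition_on (f ` X) ((`) f ` P)" by simp
    moreover have "\<not> covered ((`) f ` P) k" for k
    proof
      assume "covered ((`) f ` P) k"
      then obtain A B j y x z where h: "A \<in> P" "B \<in> P" "f ` A \<noteq> f ` B" "j \<in> B" "k = f j" "y \<in> B" "k < f y"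
        "x \<in> A" "f x < k" "z \<in> A" "k < f z"
        unfolding covered_def by blast
      then have "A \<noteq> B" by blast
      then have "covered P j" using h less sub by (intro coveredI[of A P B j y x z]) blast+
      then show False using u by blast
    qed
    ultimately show "(`) f ` P \<in> uncovered_partitions (f ` X)"
      by (simp add: uncovered_partitions_def uncovered_partition_def)
  qed
  show "finite (uncovered_partitions (f ` X))" using X finite_uncovered_partitions by blast
qed

lemma card_uncovered_gap:
  assumes "m \<ge> 1"
  shows "card (uncovered_partitions ({1..Suc m} - {m})) = card (uncovered_partitions {1..m})"
proof (rule order_antisym)
  \<comment> \<open>These increasing maps open and close the gap at \<open>m\<close>.\<close>
  define f g where "f = (\<lambda>x. if x = m then Suc m else x)" and "g = (\<lambda>x. if x = Suc m then m else x)"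
  have "f ` {1..m} = {1..Suc m} - {m}" "g ` ({1..Suc m} - {m}) = {1..m}"
    using assms by (auto simp: f_def g_def image_def)
  moreover have "strict_mono_on {1..m} f" "strict_mono_on ({1..Suc m} - {m}) g"
    by (auto simp: f_def g_def strict_mono_on_def)
  ultimately show
    "card (uncovered_partitions ({1..Suc m} - {m})) \<le> card (uncovered_partitions {1..m})"
    "card (uncovered_partitions {1..m}) \<le> card (uncovered_partitions ({1..Suc m} - {m}))"
    using card_uncovered_strict_mono_le by (metis finite_Diff finite_atLeastAtMost)+
qed

text \<open>The last point is doubled: \<open>Suc m\<close> joins the block of \<open>m\<close>.
  Then \<open>m\<close> is no longer largest in its block, but no other block has an element above
  it, so it does not become covered.\<close>

lemma card_uncovered_joined:
  assumes "m \<ge> 1"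
  shows "card {P \<in> uncovered_partitions {1..Suc m}. \<exists>C\<in>P. m \<in> C \<and> Suc m \<in> C} =
    card (uncovered_partitions {1..m})"
proof (rule bij_betw_same_card[symmetric])
  \<comment> \<open>Preimages under \<open>h\<close> add \<open>Suc m\<close> to the block of
    \<open>m\<close>; intersecting with \<open>{1..m}\<close> undoes this.\<close>
  define h where "h = (\<lambda>x. if x = Suc m then m else x)"
  have hv: "h x \<in> C \<longleftrightarrow> x \<in> C \<and> x \<noteq> Suc m \<or> x = Suc m \<and> m \<in> C" for x C by (auto simp: h_def)
  have part: "partition_on {1..Suc m} ((-`) h ` Q)" if Q: "partition_on {1..m} Q" for Q
  proof -
    have "h -` {1..m} = {1..Suc m}" using assms by (auto simp: h_def split: if_splits)
    moreover have "{} \<notin> (-`) h ` Q"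
    proof
      assume "{} \<in> (-`) h ` Q"
      then obtain C where C: "C \<in> Q" "h -` C = {}" by auto
      moreover obtain x where "x \<in> C" using block_nonempty[OF Q C(1)] by blast
      ultimately have "x \<in> h -` C" using block_subset[OF Q, of C x] unfolding vimage_eq hv by force
      then show False using C(2) by blast
    qed
    ultimately show ?thesis using partition_on_vimage[OF Q, of h] by simp
  qed
  have cov: "covered ((-`) h ` Q) j \<longleftrightarrow> covered Q j" if Q: "partition_on {1..m} Q" for Q j
  proof
    assume "covered ((-`) h ` Q) j"
    then obtain A B y x z where k: "A \<in> Q" "B \<in> Q" "A \<noteq> B" "j \<in> h -` B" "y \<in> h -` B" "j < y"
      "x \<in> h -` A" "x < j" "z \<in> h -` A" "j < z" unfolding covered_def by blast
    have le: "w \<le> Suc m" if "w \<in> h -` C" "C \<in> Q" for w C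
      using that block_subset[OF Q, of C w] unfolding vimage_eq hv by auto
    have "j \<le> m" using le[of y B] k by simp
    then have j: "j \<in> B" "x \<in> A" "x < j" using k by (auto simp: hv)
    then have "m \<notin> A \<or> m \<notin> B" using blocks_eq[OF Q k(1,2)] k(3) by blast
    \<comment> \<open>An upper witness \<open>Suc m\<close> is replaced by \<open>m\<close>, which
      works unless \<open>j = m\<close>; but then \<open>m\<close> would lie in both
      \<open>A\<close> and \<open>B\<close>.\<close>
    have "\<exists>z\<in>A. j < z"
    proof (cases "z = Suc m")
      case True
      then have "m \<in> A" using k by (auto simp: hv)
      moreover have "j \<noteq> m" using j \<open>m \<in> A\<close> \<open>m \<notin> A \<or> m \<notin> B\<close> by blast
      ultimately show ?thesis using \<open>j \<le> m\<close> by (intro bexI[of _ m]) simp_all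
    qed (use k in \<open>auto simp: hv\<close>)
    then obtain z' where z': "z' \<in> A" "j < z'" by blast
    then have "j < m" using block_subset[OF Q k(1), of z'] by simp
    moreover have "y \<in> B \<or> m \<in> B" using k by (auto simp: hv)
    ultimately obtain y' where "y' \<in> B" "j < y'" using k by blast
    then show "covered Q j" using coveredI[OF k(1-3) j(1) _ _ j(2,3) z'] by blast
  next
    assume "covered Q j"
    then obtain A B y x z where k: "A \<in> Q" "B \<in> Q" "A \<noteq> B" "j \<in> B" "y \<in> B" "j < y"
      "x \<in> A" "x < j" "z \<in> A" "j < z" unfolding covered_def by blast
    have sub: "w \<in> h -` C \<longleftrightarrow> w \<in> C" if "w \<in> C" "C \<in> Q" for w C
      using that block_subset[OF Q, of C w] by (auto simp: hv)
    have "x \<noteq> Suc m" using block_subset[OF Q k(1), of x] k by auto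
    moreover have "x \<notin> B" using blocks_eq[OF Q k(1,2)] k by blast
    ultimately have "x \<notin> h -` B" by (simp add: hv)
    then have "h -` A \<noteq> h -` B" using sub k by blast
    then show "covered ((-`) h ` Q) j"
      using k sub by (intro coveredI[of "h -` A" _ "h -` B" j y x z]) auto
  qed
  have restrict: "{1..m} \<inter> h -` C = C" if "C \<subseteq> {1..m}" for C
    using that by (auto simp: h_def)
  have restrictQ: "(\<inter>) {1..m} ` (-`) h ` Q = Q" if "partition_on {1..m} Q" for Q
  proof -
    have "{1..m} \<inter> h -` C = C" if "C \<in> Q" for C
      using restrict[of C] partition_onD1[OF \<open>partition_on {1..m} Q\<close>] that by blast
    then show ?thesis by (simp add: image_image)
  qed
  have reconstruct: "partition_on {1..m} ((\<inter>) {1..m} ` P) \<and> (-`) h ` (\<inter>) {1..m} ` P = P"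
    if P: "partition_on {1..Suc m} P" and C: "C \<in> P" "m \<in> C" "Suc m \<in> C" for P C
  proof
    \<comment> \<open>Each block has both of the last two points or neither, so restriction empties
      no block and loses no information.\<close>
    have iff: "m \<in> D \<longleftrightarrow> Suc m \<in> D" if "D \<in> P" for D
      using blocks_eq[OF P that C(1)] C by blast
    have "{} \<notin> (\<inter>) {1..m} ` P"
    proof
      assume "{} \<in> (\<inter>) {1..m} ` P"
      then obtain D where D: "D \<in> P" "{1..m} \<inter> D = {}" by auto
      moreover obtain x where "x \<in> D" using block_nonempty[OF P D(1)] by blast
      moreover from this have "x \<in> {1..Suc m}" using block_subset[OF P D(1)] by blast
      ultimately have "x = Suc m" by (auto simp: le_Suc_eq)
      then have "m \<in> D" using iff D \<open>x \<in> D\<close> by blast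
      then show False using D assms by auto
    qed
    moreover have "{1..m} \<inter> {1..Suc m} = {1..m}" by auto
    ultimately show "partition_on {1..m} ((\<inter>) {1..m} ` P)"
      using partition_on_restrict[OF P, of "{1..m}"] by simp
    have "h -` ({1..m} \<inter> D) = D" if "D \<in> P" for D
    proof (rule set_eqI)
      fix x
      show "x \<in> h -` ({1..m} \<inter> D) \<longleftrightarrow> x \<in> D"
        using iff[OF that] block_subset[OF P that, of x] assms
        unfolding vimage_eq hv by (auto simp: le_Suc_eq)
    qed
    then show "(-`) h ` (\<inter>) {1..m} ` P = P" by (simp add: image_image)
  qed
  show "bij_betw ((`) ((-`) h)) (uncovered_partitions {1..m})
      {P \<in> uncovered_partitions {1..Suc m}. \<exists>C\<in>P. m \<in> C \<and> Suc m \<in> C}"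
  proof (rule bij_betw_byWitness[where f' = "(`) ((\<inter>) {1..m})"])
    show "\<forall>Q\<in>uncovered_partitions {1..m}. (\<inter>) {1..m} ` (-`) h ` Q = Q"
      using restrictQ by (simp add: uncovered_partitions_def)
    show "\<forall>P\<in>{P \<in> uncovered_partitions {1..Suc m}. \<exists>C\<in>P. m \<in> C \<and> Suc m \<in> C}.
        (-`) h ` (\<inter>) {1..m} ` P = P"
      using reconstruct unfolding uncovered_partitions_def by blast
    show "(`) ((-`) h) ` uncovered_partitions {1..m}
        \<subseteq> {P \<in> uncovered_partitions {1..Suc m}. \<exists>C\<in>P. m \<in> C \<and> Suc m \<in> C}"
    proof (rule image_subsetI)
      fix Q assume "Q \<in> uncovered_partitions {1..m}"
      then have Q: "partition_on {1..m} Q" "\<And>j. \<not> covered Q j"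
        by (auto simp: uncovered_partitions_def uncovered_partition_def)
      have "m \<in> {1..m}" using assms by simp
      then obtain C where "C \<in> Q" "m \<in> C" using partition_onD1[OF Q(1)] by blast
      then have "h -` C \<in> (-`) h ` Q" "m \<in> h -` C" "Suc m \<in> h -` C" by (auto simp: hv)
      then show "(-`) h ` Q \<in> {P \<in> uncovered_partitions {1..Suc m}. \<exists>C\<in>P. m \<in> C \<and> Suc m \<in> C}"
        using part[OF Q(1)] cov[OF Q(1)] Q(2)
        unfolding uncovered_partitions_def uncovered_partition_def by blast
    qed
    show "(`) ((\<inter>) {1..m}) ` {P \<in> uncovered_partitions {1..Suc m}. \<exists>C\<in>P. m \<in> C \<and> Suc m \<in> C}
        \<subseteq> uncovered_partitions {1..m}"
    proof (rule image_subsetI)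
      fix P assume "P \<in> {P \<in> uncovered_partitions {1..Suc m}. \<exists>C\<in>P. m \<in> C \<and> Suc m \<in> C}"
      then obtain C where P: "partition_on {1..Suc m} P" "\<And>j. \<not> covered P j"
        and C: "C \<in> P" "m \<in> C" "Suc m \<in> C"
        by (auto simp: uncovered_partitions_def uncovered_partition_def)
      note b = reconstruct[OF P(1) C]
      then show "(\<inter>) {1..m} ` P \<in> uncovered_partitions {1..m}"
        using cov[OF conjunct1[OF b]] P(2) by (simp add: uncovered_partitions_def uncovered_partition_def)
    qed
  qed
qed

text \<open>Otherwise \<open>m\<close> and \<open>Suc m\<close> lie in different blocks, each with
  an element below \<open>m\<close>; the larger of these two elements is covered.\<close>

lemma uncovered_last_cases:
  assumes P: "P \<in> uncovered_partitions {1..Suc m}" and m: "m \<ge> 1"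
  shows "{Suc m} \<in> P \<or> (\<exists>C\<in>P. m \<in> C \<and> Suc m \<in> C) \<or> {m} \<in> P"
proof (rule ccontr)
  assume n: "\<not> ?thesis"
  have p: "partition_on {1..Suc m} P" and u: "\<And>j. \<not> covered P j"
    using P by (auto simp: uncovered_partitions_def uncovered_partition_def)
  have "m \<in> {1..Suc m}" "Suc m \<in> {1..Suc m}" using m by auto
  then obtain C D where CD: "C \<in> P" "m \<in> C" "D \<in> P" "Suc m \<in> D" using partition_onD1[OF p] by blast
  have ne: "C \<noteq> D" using n CD by blast
  have "C \<noteq> {m}" "D \<noteq> {Suc m}" using n CD by auto
  then obtain q r where qr: "q \<in> C" "q \<noteq> m" "r \<in> D" "r \<noteq> Suc m" using CD by blast
  have "q \<noteq> Suc m" "r \<noteq> m" "q \<noteq> r" using qr ne CD blocks_eq[OF p CD(1,3)] by blast+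
  then have less: "q < m" "r < m"
    using qr block_subset[OF p CD(1), of q] block_subset[OF p CD(3), of r] by auto
  consider "q < r" | "r < q" using \<open>q \<noteq> r\<close> by linarith
  then show False
  proof cases
    case 1
    then have "covered P r"
      using coveredI[OF CD(1,3) ne qr(3) CD(4) _ qr(1) _ CD(2)] less by simp
    then show ?thesis using u by blast
  next
    case 2
    then have "covered P q"
      using coveredI[OF CD(3,1) ne[symmetric] qr(1) CD(2) _ qr(3) _ CD(4)] less by simp
    then show ?thesis using u by blast
  qed
qed

lemma card_uncovered_recurrence:
  "int (card (uncovered_partitions {1..Suc (Suc n)})) =
    3 * int (card (uncovered_partitions {1..Suc n})) - int (card (uncovered_partitions {1..n}))"
proof -
  define m where "m = Suc n"
  let ?V = uncovered_partitions
  let ?X = "{1..Suc m}"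
  \<comment> \<open>The conjunct \<open>True\<close> gives the set the shape of
    \<open>card_singleton_block\<close> with a trivial \<open>R\<close>.\<close>
  let ?S = "{P \<in> ?V ?X. {Suc m} \<in> P \<and> True}"
  let ?J = "{P \<in> ?V ?X. \<exists>C\<in>P. m \<in> C \<and> Suc m \<in> C}"
  let ?T = "{P \<in> ?V ?X. {m} \<in> P \<and> {Suc m} \<notin> P}"
  have m: "m \<ge> 1" by (simp add: m_def)
  have X: "?X - {Suc m} = {1..m}" "?X - {m} - {Suc m} = {1..n}" by (auto simp: m_def)
  have S: "card ?S = card (?V {1..m})"
    using card_singleton_block[of "Suc m" ?X "\<lambda>_. True"] X by simp
  have J: "card ?J = card (?V {1..m})" using card_uncovered_joined[OF m] .
  \<comment> \<open>Deleting \<open>{m}\<close> leaves the uncovered partitions of the gapped set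
    without the block \<open>{Suc m}\<close>; those with it are counted by deleting that block
    too.\<close>
  have "card ?T = card {Q \<in> ?V (?X - {m}). {Suc m} \<notin> Q}"
    using m by (intro card_singleton_block) auto
  moreover have "card {Q \<in> ?V (?X - {m}). {Suc m} \<in> Q \<and> True} = card (?V {1..n})"
    using card_singleton_block[of "Suc m" "?X - {m}" "\<lambda>_. True"] X by simp
  moreover have "card (?V (?X - {m})) =
      card {Q \<in> ?V (?X - {m}). {Suc m} \<in> Q} + card {Q \<in> ?V (?X - {m}). {Suc m} \<notin> Q}"
    using finite_uncovered_partitions[of "?X - {m}"]
    by (subst card_Un_disjoint[symmetric]) (auto intro: arg_cong[where f = card])
  ultimately have T: "card (?V {1..m}) = card (?V {1..n}) + card ?T"
    using card_uncovered_gap[OF m] by simp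
  have fin: "finite (?V ?X)" by (simp add: finite_uncovered_partitions)
  have single: "C = {x}" if "P \<in> ?V ?X" "C \<in> P" "{x} \<in> P" "x \<in> C" for P C x
    using that blocks_eq[of ?X P C "{x}" x] by (auto simp: uncovered_partitions_def)
  have "?V ?X = ?S \<union> (?J \<union> ?T)" using uncovered_last_cases[OF _ m] by blast
  moreover have "?J \<inter> ?T = {}" "?S \<inter> (?J \<union> ?T) = {}" using single by fastforce+
  ultimately have "card (?V ?X) = card ?S + (card ?J + card ?T)"
    using fin by (metis (no_types, lifting) card_Un_disjoint finite_Un)
  then show ?thesis using S J T unfolding m_def by simp
qed

lemma card_uncovered_partitions: "int (card (uncovered_partitions {1..n})) = fib_odd n"
proof (induction n rule: fib_odd.induct)
  case 1
  have "uncovered_partitions {1..0} = {{}}"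
    by (auto simp: uncovered_partitions_def partition_on_empty uncovered_partition_def covered_def)
  then show ?case by simp
next
  case 2
  have "{P \<in> uncovered_partitions {Suc 0}. {Suc 0} \<in> P \<and> True} = uncovered_partitions {Suc 0}"
  proof -
    have "{Suc 0} \<in> P" if "partition_on {Suc 0} P" for P
      using partition_onD1[OF that] partition_onD3[OF that] by (metis Union_iff insertI1 subset_singletonD Union_upper)
    then show ?thesis by (auto simp: uncovered_partitions_def)
  qed
  moreover have "uncovered_partitions {} = {{}}"
    by (auto simp: uncovered_partitions_def partition_on_empty uncovered_partition_def covered_def)
  ultimately show ?case using card_singleton_block[of "Suc 0" "{Suc 0}" "\<lambda>_. True"] by simp
next
  case (3 n)
  then show ?case using card_uncovered_recurrence by simp
qed

section \<open>Cyclic sieving\<close>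

lemma finite_set_partitions: "finite (set_partitions n)"
  unfolding set_partitions_def by (rule finitely_many_partition_on) simp

lemma stats_uncovered:
  assumes "partition_on X P" "finite X" "uncovered_partition P"
    "stat \<in> csp_statistics"
  shows "stat P = 0"
  using assms(4) uncovered_arcs_empty[OF assms(1-3)]
  by (auto simp: stats_eq[OF assms(1,2)] nested_points_def)

text \<open>The choice turns the swap into a function of the partition alone; \<open>unique\<close>
  makes its value determined whenever a covered element exists.\<close>

definition tail_swap :: "nat set \<Rightarrow> nat set set \<Rightarrow> nat set set" where
  "tail_swap X P = (SOME Q. \<exists>j A B. least_covered X P j A B \<and> Q = swap_tails j A B P)"

lemma (in least_covered) tail_swap_eq: "tail_swap X P = swap_tails j A B P"
  unfolding tail_swap_def
proof (rule some_equality)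
  show "\<exists>k C D. least_covered X P k C D \<and> swap_tails j A B P = swap_tails k C D P"
    using least_covered_axioms by blast
  show "Q = swap_tails j A B P"
    if "\<exists>k C D. least_covered X P k C D \<and> Q = swap_tails k C D P" for Q
    using that unique by blast
qed

lemma (in least_covered) not_uncovered: "\<not> uncovered_partition P"
  using A B AB jB B_hi A_lo A_hi unfolding uncovered_partition_def covered_def by blast

text \<open>The tail swap cancels all partitions with a covered element; each remaining one has
  statistic zero and contributes \<open>1\<close>.\<close>

lemma signed_sum:
  fixes stat :: "nat set set \<Rightarrow> nat"
  assumes stat: "stat \<in> csp_statistics"
  shows "(\<Sum>P\<in>set_partitions n. (-1) ^ stat P :: int) = fib_odd n"
proof -
  let ?X = "{1..n}"
  let ?s = "\<lambda>P. (-1) ^ stat P :: int"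
  let ?C = "set_partitions n - uncovered_partitions ?X"
  have ex: "\<exists>j A B. least_covered ?X P j A B" if "P \<in> ?C" for P
    using that least_covered_exists[of ?X P] by (auto simp: set_partitions_def uncovered_partitions_def)
  have swap: "tail_swap ?X P \<in> ?C \<and> tail_swap ?X (tail_swap ?X P) = P \<and> ?s (tail_swap ?X P) = - ?s P"
    if "P \<in> ?C" for P
  proof -
    obtain j A B where "least_covered ?X P j A B" using ex[OF \<open>P \<in> ?C\<close>] by blast
    then interpret l: least_covered ?X P j A B .
    interpret s: least_covered ?X l.P' j l.A' l.B' by (rule l.swap_least_covered)
    have "?s l.P' = - ?s P"
      using l.swap_flips[OF stat] by (cases "even (stat P)") auto
    then show ?thesis
      using l.swap_partition s.not_uncovered l.swap_swap
      unfolding l.tail_swap_eq s.tail_swap_eq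
      by (simp add: set_partitions_def uncovered_partitions_def)
  qed
  \<comment> \<open>Reindexing by the swap makes this sum equal to its own negative.\<close>
  have "sum ?s ?C = (\<Sum>P\<in>?C. - ?s P)"
    by (rule sum.reindex_bij_witness[where i = "tail_swap ?X" and j = "tail_swap ?X"])
      (use swap in auto)
  then have zero: "sum ?s ?C = 0" by (simp add: sum_negf)
  have "sum ?s (set_partitions n) = sum ?s ?C + sum ?s (uncovered_partitions ?X)"
    by (rule sum.subset_diff)
      (use finite_set_partitions in \<open>auto simp: uncovered_partitions_def set_partitions_def\<close>)
  also have "sum ?s (uncovered_partitions ?X) = (\<Sum>P\<in>uncovered_partitions ?X. 1)"
    using stats_uncovered[OF _ _ _ stat] by (intro sum.cong) (auto simp: uncovered_partitions_def)
  finally show ?thesis using zero card_uncovered_partitions[of n] by simp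
qed

text \<open>At \<open>1\<close> the polynomial counts partitions for every statistic; at
  \<open>-1\<close> it is the signed sum, to be compared with the \<open>a n\<close> fixed
  points.\<close>

lemma exhibits_csp_of_signed_sum:
  assumes "\<And>n. (\<Sum>P\<in>set_partitions n. (-1) ^ stat P :: int) = a n"
  shows "exhibits_csp stat a"
  using assms
  by (auto simp: exhibits_csp_def csp_involution_def stat_gen_poly_def poly_sum poly_monom)

theorem theorem4p4:
  shows "exhibits_csp num_non_exclusive_records fib_odd
       \<and> exhibits_csp num_non_exclusive_record_openers fib_odd
       \<and> exhibits_csp num_crossings fib_odd
       \<and> exhibits_csp num_nestings fib_odd
       \<and> exhibits_csp num_opener_crossings fib_odd
       \<and> exhibits_csp num_opener_nestings fib_odd
       \<and> exhibits_csp num_non_block_records fib_odd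
       \<and> exhibits_csp num_non_block_record_openers fib_odd
       \<and> exhibits_csp num_overlaps fib_odd
       \<and> exhibits_csp num_coverings fib_odd"
  by (intro conjI exhibits_csp_of_signed_sum signed_sum) simp_all

end
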